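(* Let $F\colon\mathscr{P}_2(\mathbb{R}^d)\to\mathbb{R}$ and let $\lambda\in\mathbb{R}$. If $F$ is differentiable on $\mathscr{P}_2(\mathbb{R}^d)$, then $F$ is $\lambda$-geodesically convex if and only if, for all $\mu_1,\mu_2\in\mathscr{P}_2(\mathbb{R}^d)$ and all $\gamma\in\Gamma_o(\mu_1,\mu_2)$, $$\int_{(\mathbb{R}^d)^2}\big(\nabla_wF[\mu_2](x_2)-\nabla_wF[\mu_1](x_1)\big)\cdot(x_2-x_1)\,d\gamma(x_1,x_2)\ \ge\ \lambda\,W_2^2(\mu_1,\mu_2).$$
   Context: $\mathscr{P}_2(\mathbb{R}^d)$ is the set of Borel probability measures on $\mathbb{R}^d$ with finite second moment, endowed with the $2$-Wasserstein distance $W_2(\mu,\nu)=\inf\{(\int|x_1-x_2|^2\,d\gamma)^{1/2}:\gamma\in\Gamma(\mu,\nu)\}$, where $\Gamma(\mu,\nu)$ is the set of $\gamma\in\mathscr{P}_2(\mathbb{R}^d\times\mathbb{R}^d)$ with first marginal $\mu$ and second marginal $\nu$. $\Gamma_o(\mu,\nu)$ is the set of $\gamma\in\Gamma(\mu,\nu)$ with $\int|x_1-x_2|^2\,d\gamma=W_2^2(\mu,\nu)$. $\pi^1,\pi^2$ are the coordinate projections and $_{\#}$ denotes pushforward. Differentiability: for $\mu\in\mathscr{P}_2(\mathbb{R}^d)$ and $\xi\in L^2(\mu;\mathbb{R}^d)$, write $\xi\in\partial F[\mu]$ if $F(\nu)-F(\mu)=\int\xi(x_1)\cdot(x_2-x_1)\,d\gamma(x_1,x_2)+o(W_2(\mu,\nu))$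 for all $\nu\in\mathscr{P}_2(\mathbb{R}^d)$ and all $\gamma\in\Gamma_o(\mu,\nu)$ (for every $\epsilon>0$ there is $\delta>0$ such that the error is at most $\epsilon W_2(\mu,\nu)$ in absolute value for all $\nu$ with $W_2(\mu,\nu)<\delta$ and all $\gamma\in\Gamma_o(\mu,\nu)$). $F$ is differentiable at $\mu$ if $\partial F[\mu]\ne\varnothing$, and the Wasserstein gradient $\nabla_wF[\mu]$ is then the element of $\partial F[\mu]$ of minimal $L^2(\mu;\mathbb{R}^d)$-norm. $F$ is differentiable on $\mathscr{P}_2(\mathbb{R}^d)$ if it is differentiable at every $\mu$. A curve $[0,1]\ni t\mapsto\mu_t$ is a geodesic between $\mu_1$ and $\mu_2$ if there is $\gamma\in\Gamma_o(\mu_1,\mu_2)$ with $\mu_t=((1-t)\pi^1+t\pi^2)_{\#}\gamma$ for all $t\in[0,1]$. $F$ is $\lambda$-geodesically convex if between every pair $\mu_1,\mu_2\in\mathscr{P}_2(\mathbb{R}^d)$ there exists a geodesic $t\mapsto\mu_t$ such that $F(\mu_t)\le(1-t)F(\mu_1)+tF(\mu_2)-\frac{\lambda}{2}t(1-t)W_2^2(\mu_1,\mu_2)$ for all $t\in[0,1]$. *)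

theory Defs
  imports "HOL-Probability.Probability"
begin

definition P2 :: "'a::euclidean_space measure set" where
  "P2 = {\<mu>. sets \<mu> = sets borel \<and> prob_space \<mu> \<and> integrable \<mu> (\<lambda>x. (norm x)\<^sup>2)}"

definition plans :: "'a::euclidean_space measure \<Rightarrow> 'a measure \<Rightarrow> ('a \<times> 'a) measure set" where
  "plans \<mu> \<nu> = {\<gamma> \<in> P2. distr \<gamma> borel fst = \<mu> \<and> distr \<gamma> borel snd = \<nu>}"

definition transport_cost :: "('a::euclidean_space \<times> 'a) measure \<Rightarrow> real" where
  "transport_cost \<gamma> = (\<integral>x. (norm (fst x - snd x))\<^sup>2 \<partial>\<gamma>)"

definition W2 :: "'a::euclidean_space measure \<Rightarrow> 'a measure \<Rightarrow> real" where
  "W2 \<mu> \<nu> = (INF \<gamma>\<in>plans \<mu> \<nu>. sqrt (transport_cost \<gamma>))"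

definition optimal_plans :: "'a::euclidean_space measure \<Rightarrow> 'a measure \<Rightarrow> ('a \<times> 'a) measure set" where
  "optimal_plans \<mu> \<nu> = {\<gamma> \<in> plans \<mu> \<nu>. transport_cost \<gamma> = (W2 \<mu> \<nu>)\<^sup>2}"

text \<open>Elements of \<open>L\<^sup>2(\<mu>; \<real>\<^sup>d)\<close> are represented by Borel functions, without passing to the quotient by
  almost-everywhere equality.\<close>

definition L2 :: "'a::euclidean_space measure \<Rightarrow> ('a \<Rightarrow> 'a) set" where
  "L2 \<mu> = {\<xi> \<in> borel_measurable \<mu>. integrable \<mu> (\<lambda>x. (norm (\<xi> x))\<^sup>2)}"

definition L2_norm :: "'a::euclidean_space measure \<Rightarrow> ('a \<Rightarrow> 'a) \<Rightarrow> real" where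
  "L2_norm \<mu> \<xi> = sqrt (\<integral>x. (norm (\<xi> x))\<^sup>2 \<partial>\<mu>)"

text \<open>A functional on \<open>P2\<close> is given as a function on all measures; only its values on \<open>P2\<close>
  enter the definitions below.\<close>

definition wasserstein_differential ::
    "('a::euclidean_space measure \<Rightarrow> real) \<Rightarrow> 'a measure \<Rightarrow> ('a \<Rightarrow> 'a) set" where
  "wasserstein_differential F \<mu> = {\<xi> \<in> L2 \<mu>.
     \<forall>\<epsilon>>0. \<exists>\<delta>>0. \<forall>\<nu>\<in>P2. W2 \<mu> \<nu> < \<delta> \<longrightarrow> (\<forall>\<gamma>\<in>optimal_plans \<mu> \<nu>.
       \<bar>F \<nu> - F \<mu> - (\<integral>x. \<xi> (fst x) \<bullet> (snd x - fst x) \<partial>\<gamma>)\<bar> \<le> \<epsilon> * W2 \<mu> \<nu>)}"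

definition wasserstein_differentiable_at ::
    "('a::euclidean_space measure \<Rightarrow> real) \<Rightarrow> 'a measure \<Rightarrow> bool" where
  "wasserstein_differentiable_at F \<mu> \<longleftrightarrow> wasserstein_differential F \<mu> \<noteq> {}"

definition wasserstein_differentiable :: "('a::euclidean_space measure \<Rightarrow> real) \<Rightarrow> bool" where
  "wasserstein_differentiable F \<longleftrightarrow> (\<forall>\<mu>\<in>P2. wasserstein_differentiable_at F \<mu>)"

text \<open>The minimizer is unique only up to \<open>\<mu>\<close>-almost-everywhere equality; \<open>arg_min_on\<close> picks a
  Borel representative of it.\<close>

definition wasserstein_gradient ::
    "('a::euclidean_space measure \<Rightarrow> real) \<Rightarrow> 'a measure \<Rightarrow> 'a \<Rightarrow> 'a" where
  "wasserstein_gradient F \<mu> = arg_min_on (L2_norm \<mu>) (wasserstein_differential F \<mu>)"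

definition wasserstein_geodesic ::
    "'a::euclidean_space measure \<Rightarrow> 'a measure \<Rightarrow> (real \<Rightarrow> 'a measure) \<Rightarrow> bool" where
  "wasserstein_geodesic \<mu>1 \<mu>2 m \<longleftrightarrow> (\<exists>\<gamma>\<in>optimal_plans \<mu>1 \<mu>2. \<forall>t\<in>{0..1}.
     m t = distr \<gamma> borel (\<lambda>x. (1 - t) *\<^sub>R fst x + t *\<^sub>R snd x))"

definition geodesically_convex :: "real \<Rightarrow> ('a::euclidean_space measure \<Rightarrow> real) \<Rightarrow> bool" where
  "geodesically_convex lam F \<longleftrightarrow> (\<forall>\<mu>1\<in>P2. \<forall>\<mu>2\<in>P2. \<exists>m. wasserstein_geodesic \<mu>1 \<mu>2 m \<and>
     (\<forall>t\<in>{0..1}. F (m t) \<le> (1 - t) * F \<mu>1 + t * F \<mu>2 - lam / 2 * t * (1 - t) * (W2 \<mu>1 \<mu>2)\<^sup>2))"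

end

theory Submission
  imports Defs
begin

text \<open>
  Fix an optimal plan \<open>\<gamma>\<close> from \<open>\<mu>\<close> to \<open>\<nu>\<close>, write \<open>x\<^sub>t = (1 - t) x\<^sub>0 + t x\<^sub>1\<close> for the points on the segments that
  \<open>\<gamma>\<close> charges and \<open>\<mu>\<^sub>t\<close> for the law of \<open>x\<^sub>t\<close>. By the triangle inequality for \<open>W2\<close>, the joint law of
  \<open>(x\<^sub>s, x\<^sub>t)\<close> is an optimal plan between \<open>\<mu>\<^sub>s\<close> and \<open>\<mu>\<^sub>t\<close>, and its displacement is \<open>(t - s) (x\<^sub>1 - x\<^sub>0)\<close>.
  Inserting this plan into the definition of the differential shows that \<open>f t = F \<mu>\<^sub>t\<close> is differentiable
  on \<open>[0, 1]\<close> with derivative the integral of \<open>\<nabla>F[\<mu>\<^sub>t](x\<^sub>t) \<bullet> (x\<^sub>1 - x\<^sub>0)\<close> (\<open>derivative_along_geodesic\<close>). Up to the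
  quadratic term with factor \<open>lam\<close>, the theorem thus becomes the one-dimensional fact that a differentiable
  function is convex if and only if its derivative increases. Three points need more than this.

  First, monotonicity has to be turned into convexity along at least one geodesic, so optimal plans must
  exist (\<open>optimal_plan_exists\<close>). The values of a minimizing sequence of plans on all sets
  converge along a filter, by Tychonoff's theorem. The limit is only finitely additive, but since
  its marginals are honest measures it is countably additive on rectangles, and the quadratic cost
  passes to the limit because it is determined by the marginals and by the integral of \<open>x \<bullet> y\<close>.

  Second, convexity is assumed along one geodesic only, whereas monotonicity is claimed for every optimal
  plan. Here the interior points of a geodesic help: geodesics do not branch there. If \<open>0 < t < 1\<close> and
  \<open>\<sigma>\<close> is any optimal plan from \<open>\<mu>\<^sub>t\<close> to \<open>\<nu>\<close>, then gluing \<open>\<sigma>\<close> to the first part of \<open>\<gamma>\<close> makes the triangle inequality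
  an equality, which forces the displacements on both sides of \<open>\<mu>\<^sub>t\<close> to be parallel in \<open>L\<^sup>2\<close>. Consequently the
  derivative of \<open>F\<close> at \<open>\<mu>\<^sub>t\<close> along \<open>\<sigma>\<close> is \<open>1 - t\<close> times the one along \<open>\<gamma>\<close> (\<open>barycentre_of_aligned_plans\<close>,
  \<open>slope_determined_at_interior_point\<close>). So convexity along whichever geodesics join \<open>\<mu>\<^sub>t\<close> to \<open>\<mu>\<close> and to \<open>\<nu>\<close>
  gives lower bounds for \<open>F \<mu>\<close> and \<open>F \<nu>\<close> with the same slope; their convex combination is convexity along \<open>\<gamma>\<close>
  (\<open>convexity_along_every_geodesic\<close>).

  Third, the gradient must be an element of the differential. The differential is midpoint convex and
  closed in \<open>L\<^sup>2\<close>, so it has an element of minimal norm (\<open>exists_minimal_norm2\<close>).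

  Gluing of plans is done approximately: two plans with a common marginal are coupled so that the two
  copies of the middle point lie in the same cell of a fine countable partition. This suffices because
  all conclusions are estimates that survive the limit of vanishing cell size.
\<close>

section \<open>Square-integrable maps\<close>

text \<open>
  The set \<open>L2\<close> consists of maps from a space to itself. Displacements are vector-valued maps on a product
  space or on a space of gluings, so here domain and codomain are independent.
\<close>

definition square_integrable :: "'a measure \<Rightarrow> ('a \<Rightarrow> 'b::euclidean_space) \<Rightarrow> bool" where
  "square_integrable M f \<longleftrightarrow> f \<in> borel_measurable M \<and> integrable M (\<lambda>x. (norm (f x))\<^sup>2)"

definition norm2 :: "'a measure \<Rightarrow> ('a \<Rightarrow> 'b::euclidean_space) \<Rightarrow> real" where
  "norm2 M f = sqrt (\<integral>x. (norm (f x))\<^sup>2 \<partial>M)"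

lemma square_integrable_measurable:
  "square_integrable M f \<Longrightarrow> f \<in> borel_measurable M"
  by (simp add: square_integrable_def)

lemma norm2_nonneg [simp]: "0 \<le> norm2 M f"
  by (simp add: norm2_def)

lemma norm2_squared: "(norm2 M f)\<^sup>2 = (\<integral>x. f x \<bullet> f x \<partial>M)"
  by (simp add: norm2_def power2_norm_eq_inner)

lemma norm2_diff_commute: "norm2 M (\<lambda>x. f x - g x) = norm2 M (\<lambda>x. g x - f x)"
  by (simp add: norm2_def norm_minus_commute)

lemma square_integrable_inner:
  assumes f: "square_integrable M f" and g: "square_integrable M g"
  shows "integrable M (\<lambda>x. f x \<bullet> g x)"
proof (rule Bochner_Integration.integrable_bound)
  show "integrable M (\<lambda>x. (norm (f x))\<^sup>2 + (norm (g x))\<^sup>2)"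
    using f g by (simp add: square_integrable_def)
  show "(\<lambda>x. f x \<bullet> g x) \<in> borel_measurable M"
    using f g by (auto simp: square_integrable_def)
  have "\<bar>f x \<bullet> g x\<bar> \<le> (norm (f x))\<^sup>2 + (norm (g x))\<^sup>2" for x
  proof -
    have "\<bar>f x \<bullet> g x\<bar> \<le> norm (f x) * norm (g x)" by (rule Cauchy_Schwarz_ineq2)
    moreover have "0 \<le> norm (f x) * norm (g x)" by simp
    moreover have "2 * (norm (f x) * norm (g x)) \<le> (norm (f x))\<^sup>2 + (norm (g x))\<^sup>2"
      using sum_squares_bound[of "norm (f x)" "norm (g x)"] by simp
    ultimately show ?thesis by linarith
  qed
  then show "AE x in M. norm (f x \<bullet> g x) \<le> norm ((norm (f x))\<^sup>2 + (norm (g x))\<^sup>2)"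
    by simp
qed

lemma square_integrable_scaleR:
  "square_integrable M f \<Longrightarrow> square_integrable M (\<lambda>x. c *\<^sub>R f x)"
  by (auto simp: square_integrable_def power_mult_distrib)

lemma square_integrable_add:
  assumes f: "square_integrable M f" and g: "square_integrable M g"
  shows "square_integrable M (\<lambda>x. f x + g x)"
proof -
  have "integrable M (\<lambda>x. f x \<bullet> f x + 2 * (f x \<bullet> g x) + g x \<bullet> g x)"
    using square_integrable_inner[OF f f] square_integrable_inner[OF f g]
      square_integrable_inner[OF g g] by simp
  moreover have "f x \<bullet> f x + 2 * (f x \<bullet> g x) + g x \<bullet> g x = (norm (f x + g x))\<^sup>2" for x
    by (simp add: power2_norm_eq_inner inner_add_left inner_add_right inner_commute)
  ultimately show ?thesis using f g by (auto simp: square_integrable_def)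
qed

lemma square_integrable_diff:
  assumes "square_integrable M f" and "square_integrable M g"
  shows "square_integrable M (\<lambda>x. f x - g x)"
  using square_integrable_add[OF assms(1) square_integrable_scaleR[OF assms(2), of "-1"]] by simp

lemma norm2_scaleR: "norm2 M (\<lambda>x. c *\<^sub>R f x) = \<bar>c\<bar> * norm2 M f"
  by (simp add: norm2_def power_mult_distrib real_sqrt_mult)

lemma norm2_lincomb_squared:
  assumes f: "square_integrable M f" and g: "square_integrable M g"
  shows "(norm2 M (\<lambda>x. a *\<^sub>R f x + b *\<^sub>R g x))\<^sup>2
    = a\<^sup>2 * (norm2 M f)\<^sup>2 + 2 * a * b * (\<integral>x. f x \<bullet> g x \<partial>M) + b\<^sup>2 * (norm2 M g)\<^sup>2"
proof -
  have "(norm2 M (\<lambda>x. a *\<^sub>R f x + b *\<^sub>R g x))\<^sup>2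
      = (\<integral>x. a\<^sup>2 * (f x \<bullet> f x) + (2 * a * b) * (f x \<bullet> g x) + b\<^sup>2 * (g x \<bullet> g x) \<partial>M)"
    unfolding norm2_squared
    by (rule Bochner_Integration.integral_cong) (auto simp: inner_add_left inner_add_right inner_commute power2_eq_square algebra_simps)
  also have "\<dots> = a\<^sup>2 * (norm2 M f)\<^sup>2 + 2 * a * b * (\<integral>x. f x \<bullet> g x \<partial>M) + b\<^sup>2 * (norm2 M g)\<^sup>2"
    unfolding norm2_squared
    using square_integrable_inner[OF f f] square_integrable_inner[OF f g]
      square_integrable_inner[OF g g] by simp
  finally show ?thesis .
qed

lemma norm2_eq_0_AE:
  assumes "square_integrable M f" "norm2 M f = 0"
  shows "AE x in M. f x = 0"
proof -
  have "(\<integral>x. (norm (f x))\<^sup>2 \<partial>M) = 0" using assms(2) by (simp add: norm2_def)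
  then show ?thesis
    using integral_nonneg_eq_0_iff_AE[of M "\<lambda>x. (norm (f x))\<^sup>2"] assms(1)
    by (simp add: square_integrable_def)
qed

lemma Cauchy_Schwarz_integral:
  assumes f: "square_integrable M f" and g: "square_integrable M g"
  shows "\<bar>\<integral>x. f x \<bullet> g x \<partial>M\<bar> \<le> norm2 M f * norm2 M g"
proof -
  define a where "a = norm2 M f"
  define b where "b = norm2 M g"
  define c where "c = (\<integral>x. f x \<bullet> g x \<partial>M)"
  have ab: "0 \<le> a" "0 \<le> b" by (simp_all add: a_def b_def)
  show ?thesis
  proof (cases "a = 0 \<or> b = 0")
    case True
    then have "AE x in M. f x \<bullet> g x = 0"
      using norm2_eq_0_AE[OF f] norm2_eq_0_AE[OF g] unfolding a_def b_def by auto
    then have "c = 0" unfolding c_def by (rule integral_eq_zero_AE)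
    then show ?thesis using ab by (simp add: a_def b_def c_def)
  next
    case False
    then have pos: "0 < a * b" using ab by simp
    \<comment> \<open>One of \<open>b f + a g\<close> and \<open>b f - a g\<close> vanishes when equality holds.\<close>
    have "0 \<le> (norm2 M (\<lambda>x. b *\<^sub>R f x + s *\<^sub>R g x))\<^sup>2" for s by simp
    then have *: "0 \<le> b\<^sup>2 * a\<^sup>2 + 2 * b * s * c + s\<^sup>2 * b\<^sup>2" for s
      by (simp add: norm2_lincomb_squared[OF f g] a_def b_def c_def)
    have "0 \<le> (a * b) * (a * b + c)" "0 \<le> (a * b) * (a * b - c)"
      using *[of a] *[of "-a"] by (simp_all add: power2_eq_square algebra_simps)
    then have "0 \<le> a * b + c" "0 \<le> a * b - c"
      using pos by (simp_all add: zero_le_mult_iff)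
    then show ?thesis by (simp add: a_def b_def c_def)
  qed
qed

lemma norm2_triangle:
  assumes f: "square_integrable M f" and g: "square_integrable M g"
  shows "norm2 M (\<lambda>x. f x + g x) \<le> norm2 M f + norm2 M g"
proof (rule power2_le_imp_le)
  have "(norm2 M (\<lambda>x. f x + g x))\<^sup>2
      = (norm2 M f)\<^sup>2 + 2 * (\<integral>x. f x \<bullet> g x \<partial>M) + (norm2 M g)\<^sup>2"
    using norm2_lincomb_squared[OF f g, of 1 1] by simp
  also have "\<dots> \<le> (norm2 M f + norm2 M g)\<^sup>2"
    using Cauchy_Schwarz_integral[OF f g] by (simp add: power2_sum)
  finally show "(norm2 M (\<lambda>x. f x + g x))\<^sup>2 \<le> (norm2 M f + norm2 M g)\<^sup>2" .
qed simp

lemma (in prob_space) norm2_le_bound: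
  assumes "f \<in> borel_measurable M" "AE x in M. norm (f x) \<le> c" "0 \<le> c"
  shows "square_integrable M f" "norm2 M f \<le> c"
proof -
  have AE: "AE x in M. (norm (f x))\<^sup>2 \<le> c\<^sup>2"
    using assms(2) by eventually_elim (simp add: power_mono)
  show si: "square_integrable M f"
    unfolding square_integrable_def
    using assms(1) AE by (auto intro!: integrable_const_bound[where B = "c\<^sup>2"])
  have "(\<integral>x. (norm (f x))\<^sup>2 \<partial>M) \<le> (\<integral>x. c\<^sup>2 \<partial>M)"
    using AE si by (intro integral_mono_AE) (auto simp: square_integrable_def)
  then have "(norm2 M f)\<^sup>2 \<le> c\<^sup>2" by (simp add: norm2_def prob_space)
  then show "norm2 M f \<le> c" using assms(3) by (rule power2_le_imp_le)
qed

lemma (in prob_space) square_integrable_integrable_norm: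
  assumes f: "square_integrable M f"
  shows "integrable M f" "(\<integral>x. norm (f x) \<partial>M) \<le> norm2 M f"
proof -
  have nf: "square_integrable M (\<lambda>x. norm (f x))"
    using f by (auto simp: square_integrable_def)
  have one: "square_integrable M (\<lambda>x. 1::real)"
    by (simp add: square_integrable_def)
  have "norm2 M (\<lambda>x. 1::real) = 1" by (simp add: norm2_def prob_space)
  moreover have "norm2 M (\<lambda>x. norm (f x)) = norm2 M f" by (simp add: norm2_def)
  ultimately show "(\<integral>x. norm (f x) \<partial>M) \<le> norm2 M f"
    using Cauchy_Schwarz_integral[OF nf one] by simp
  show "integrable M f"
    using square_integrable_inner[OF nf one] f
    by (simp add: square_integrable_def integrable_norm_iff)
qed

lemma square_integrable_distr:
  assumes "T \<in> measurable M N" "f \<in> borel_measurable N"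
  shows "square_integrable (distr M N T) f \<longleftrightarrow> square_integrable M (\<lambda>x. f (T x))"
  using assms by (simp add: square_integrable_def integrable_distr_eq)

lemma norm2_distr:
  assumes "T \<in> measurable M N" "f \<in> borel_measurable N"
  shows "norm2 (distr M N T) f = norm2 M (\<lambda>x. f (T x))"
  using assms by (simp add: norm2_def integral_distr)

section \<open>Elements of minimal norm\<close>

lemma norm2_Fatou:
  fixes f :: "'a \<Rightarrow> 'b::euclidean_space"
  assumes f [measurable]: "f \<in> borel_measurable M"
    and s: "\<And>n. square_integrable M (s n)"
    and lim: "AE x in M. (\<lambda>n. s n x) \<longlonglongrightarrow> f x"
    and bound: "\<forall>\<^sub>F n in sequentially. norm2 M (s n) \<le> c" and c: "0 \<le> c"
  shows "square_integrable M f" "norm2 M f \<le> c"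
proof -
  have [measurable]: "s n \<in> borel_measurable M" for n
    using s by (rule square_integrable_measurable)
  have "(\<integral>\<^sup>+x. ennreal ((norm (f x))\<^sup>2) \<partial>M)
      = (\<integral>\<^sup>+x. liminf (\<lambda>n. ennreal ((norm (s n x))\<^sup>2)) \<partial>M)"
  proof (rule nn_integral_cong_AE)
    show "AE x in M. ennreal ((norm (f x))\<^sup>2) = liminf (\<lambda>n. ennreal ((norm (s n x))\<^sup>2))"
      using lim
    proof eventually_elim
      case (elim x)
      have "(\<lambda>n. ennreal ((norm (s n x))\<^sup>2)) \<longlonglongrightarrow> ennreal ((norm (f x))\<^sup>2)"
        by (intro tendsto_ennrealI tendsto_power tendsto_norm elim)
      then show ?case by (rule lim_imp_Liminf[OF sequentially_bot, symmetric])
    qed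
  qed
  also have "\<dots> \<le> liminf (\<lambda>n. \<integral>\<^sup>+x. ennreal ((norm (s n x))\<^sup>2) \<partial>M)"
    by (rule nn_integral_liminf) simp
  also have "\<dots> \<le> ennreal (c\<^sup>2)"
  proof -
    have "\<forall>\<^sub>F n in sequentially. (\<integral>\<^sup>+x. ennreal ((norm (s n x))\<^sup>2) \<partial>M) \<le> ennreal (c\<^sup>2)"
      using bound
    proof eventually_elim
      case (elim n)
      have "(\<integral>\<^sup>+x. ennreal ((norm (s n x))\<^sup>2) \<partial>M) = ennreal ((norm2 M (s n))\<^sup>2)"
        using s[of n] by (subst nn_integral_eq_integral) (simp_all add: square_integrable_def norm2_def)
      then show ?case using elim by (simp add: ennreal_leI power_mono)
    qed
    then show ?thesis
      by (intro order_trans[OF Liminf_le_Limsup Limsup_bounded]) simp_all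
  qed
  finally have le: "(\<integral>\<^sup>+x. ennreal ((norm (f x))\<^sup>2) \<partial>M) \<le> ennreal (c\<^sup>2)" .
  have int: "integrable M (\<lambda>x. (norm (f x))\<^sup>2)"
    using le by (intro integrableI_bounded) (auto simp: less_top[symmetric] top_unique)
  then show "square_integrable M f" by (simp add: square_integrable_def)
  have "ennreal ((norm2 M f)\<^sup>2) \<le> ennreal (c\<^sup>2)"
    using le int by (subst (asm) nn_integral_eq_integral) (simp_all add: norm2_def)
  then have "(norm2 M f)\<^sup>2 \<le> c\<^sup>2" by (simp add: ennreal_le_iff)
  then show "norm2 M f \<le> c" using c by (rule power2_le_imp_le)
qed

text \<open>
  Completeness of \<open>L\<^sup>2\<close>. The norm dominates the \<open>L\<^sup>1\<close> norm on a probability space, so a subsequence converges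
  almost everywhere; Fatou's lemma, applied to the differences, shows that its pointwise limit is the
  limit in \<open>L\<^sup>2\<close>.
\<close>

lemma (in prob_space) norm2_Cauchy_limit:
  fixes s :: "nat \<Rightarrow> 'a \<Rightarrow> 'b::euclidean_space"
  assumes s: "\<And>n. square_integrable M (s n)"
    and Cauchy: "\<And>e. e > 0 \<Longrightarrow> \<exists>N. \<forall>i\<ge>N. \<forall>j\<ge>N. norm2 M (\<lambda>x. s i x - s j x) < e"
  shows "\<exists>f. square_integrable M f \<and> (\<forall>e>0. \<exists>N. \<forall>i\<ge>N. norm2 M (\<lambda>x. f x - s i x) \<le> e)"
proof -
  have [measurable]: "s n \<in> borel_measurable M" for n
    using s by (rule square_integrable_measurable)
  have "\<exists>N. \<forall>i\<ge>N. \<forall>j\<ge>N. (LINT x|M. norm (s i x - s j x)) < e" if "e > 0" for e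
  proof -
    obtain N where N: "\<forall>i\<ge>N. \<forall>j\<ge>N. norm2 M (\<lambda>x. s i x - s j x) < e" using Cauchy[OF \<open>e > 0\<close>] by blast
    have "(LINT x|M. norm (s i x - s j x)) < e" if "i \<ge> N" "j \<ge> N" for i j
      using square_integrable_integrable_norm(2)[OF square_integrable_diff[OF s[of i] s[of j]]] N that
      by (meson order.strict_trans1)
    then show ?thesis by blast
  qed
  then obtain r where r: "strict_mono r" and AE: "AE x in M. Cauchy (\<lambda>i. s (r i) x)"
    by (rule cauchy_L1_AE_cauchy_subseq[OF square_integrable_integrable_norm(1)[OF s]])
  define f where "f x = lim (\<lambda>i. s (r i) x)" for x
  have [measurable]: "f \<in> borel_measurable M"
    unfolding f_def by measurable
  have lim: "AE x in M. (\<lambda>i. s (r i) x) \<longlonglongrightarrow> f x"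
    using AE by eventually_elim (simp add: f_def Cauchy_convergent convergent_LIMSEQ_iff[symmetric])
  have near: "square_integrable M (\<lambda>x. f x - s i x) \<and> norm2 M (\<lambda>x. f x - s i x) \<le> e"
    if e: "e > 0" and N: "\<forall>i\<ge>N. \<forall>j\<ge>N. norm2 M (\<lambda>x. s i x - s j x) < e" and i: "i \<ge> N" for e N i
  proof -
    have l: "AE x in M. (\<lambda>n. s (r n) x - s i x) \<longlonglongrightarrow> f x - s i x"
      using lim by eventually_elim (intro tendsto_intros)
    have b: "\<forall>\<^sub>F n in sequentially. norm2 M (\<lambda>x. s (r n) x - s i x) \<le> e"
      using eventually_ge_at_top[of N]
    proof eventually_elim
      case (elim n)
      then have "r n \<ge> N" using seq_suble[OF r, of n] by linarith
      then show ?case using N i by (simp add: less_imp_le)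
    qed
    show ?thesis
      using norm2_Fatou[of "\<lambda>x. f x - s i x" M "\<lambda>n x. s (r n) x - s i x" e] l b e
        square_integrable_diff[OF s s] by simp
  qed
  have "square_integrable M f"
  proof -
    obtain N where "\<forall>i\<ge>N. \<forall>j\<ge>N. norm2 M (\<lambda>x. s i x - s j x) < 1" using Cauchy[of 1] by auto
    then have "square_integrable M (\<lambda>x. f x - s N x)" using near[of 1 N N] by simp
    from square_integrable_add[OF this s[of N]] show ?thesis by simp
  qed
  moreover have "\<exists>N. \<forall>i\<ge>N. norm2 M (\<lambda>x. f x - s i x) \<le> e" if e: "e > 0" for e
  proof -
    obtain N where "\<forall>i\<ge>N. \<forall>j\<ge>N. norm2 M (\<lambda>x. s i x - s j x) < e" using Cauchy[OF e] by blast
    then have "\<forall>i\<ge>N. norm2 M (\<lambda>x. f x - s i x) \<le> e" using near[OF e] by blast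
    then show ?thesis ..
  qed
  ultimately show ?thesis by blast
qed

lemma ex_divide_Suc_less:
  assumes "0 < (e::real)"
  shows "\<exists>N. c / real (Suc N) < e"
proof -
  obtain N where "c / e < real N" using reals_Archimedean2[of "c / e"] by blast
  then have "c / e < real (Suc N)" by simp
  then have "c / real (Suc N) < e"
    using assms by (simp add: pos_divide_less_eq mult.commute del: of_nat_Suc)
  then show ?thesis ..
qed

text \<open>
  By the parallelogram identity, two elements of almost minimal norm whose midpoint lies in \<open>S\<close> as
  well are close to each other, so a minimizing sequence is a Cauchy sequence.
\<close>

lemma (in prob_space) exists_minimal_norm2:
  fixes S :: "('a \<Rightarrow> 'b::euclidean_space) set"
  assumes nonempty: "S \<noteq> {}"
    and S: "\<And>f. f \<in> S \<Longrightarrow> square_integrable M f"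
    and mid: "\<And>f g. f \<in> S \<Longrightarrow> g \<in> S \<Longrightarrow> (\<lambda>x. (1/2) *\<^sub>R f x + (1/2) *\<^sub>R g x) \<in> S"
    and closed: "\<And>f. square_integrable M f \<Longrightarrow>
      (\<And>e. e > 0 \<Longrightarrow> \<exists>g\<in>S. norm2 M (\<lambda>x. f x - g x) \<le> e) \<Longrightarrow> f \<in> S"
  shows "\<exists>f\<in>S. \<forall>g\<in>S. norm2 M f \<le> norm2 M g"
proof -
  define I where "I = (INF g\<in>S. (norm2 M g)\<^sup>2)"
  have bdd: "bdd_below ((\<lambda>g. (norm2 M g)\<^sup>2) ` S)"
    by (rule bdd_belowI[of _ 0]) auto
  have lower: "I \<le> (norm2 M g)\<^sup>2" if "g \<in> S" for g
    unfolding I_def by (rule cINF_lower[OF bdd that])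
  have "\<exists>g\<in>S. (norm2 M g)\<^sup>2 < I + e" if "e > 0" for e
    using cINF_less_iff[OF nonempty bdd, of "I + e"] that unfolding I_def by simp
  then have "\<exists>g\<in>S. (norm2 M g)\<^sup>2 < I + 1 / Suc n" for n by simp
  then obtain s where s: "\<And>n. s n \<in> S" "\<And>n. (norm2 M (s n))\<^sup>2 < I + 1 / Suc n" by metis
  note si = S[OF s(1)]
  have par: "(norm2 M (\<lambda>x. s i x - s j x))\<^sup>2 \<le> 2 / Suc i + 2 / Suc j" for i j
  proof -
    have "(norm2 M (\<lambda>x. s i x - s j x))\<^sup>2
        = (norm2 M (s i))\<^sup>2 - 2 * (\<integral>x. s i x \<bullet> s j x \<partial>M) + (norm2 M (s j))\<^sup>2"
      using norm2_lincomb_squared[OF si[of i] si[of j], of 1 "-1"] by simp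
    moreover have "4 * (norm2 M (\<lambda>x. (1/2) *\<^sub>R s i x + (1/2) *\<^sub>R s j x))\<^sup>2
        = (norm2 M (s i))\<^sup>2 + 2 * (\<integral>x. s i x \<bullet> s j x \<partial>M) + (norm2 M (s j))\<^sup>2"
      unfolding norm2_lincomb_squared[OF si[of i] si[of j]] by (simp add: power2_eq_square)
    ultimately show ?thesis
      using lower[OF mid[OF s(1)[of i] s(1)[of j]]] s(2)[of i] s(2)[of j]
      by linarith
  qed
  have "\<exists>N. \<forall>i\<ge>N. \<forall>j\<ge>N. norm2 M (\<lambda>x. s i x - s j x) < e" if e: "e > 0" for e
  proof -
    obtain N where N: "4 / real (Suc N) < e\<^sup>2" using ex_divide_Suc_less[of "e\<^sup>2" 4] e by auto
    have "norm2 M (\<lambda>x. s i x - s j x) < e" if ij: "i \<ge> N" "j \<ge> N" for i j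
    proof (rule power2_less_imp_less)
      have "2 / Suc i \<le> 2 / Suc N" "2 / Suc j \<le> 2 / Suc N"
        using ij by (auto intro!: divide_left_mono)
      then show "(norm2 M (\<lambda>x. s i x - s j x))\<^sup>2 < e\<^sup>2"
        using par[of i j] N by linarith
    qed (use e in simp)
    then show ?thesis by blast
  qed
  from norm2_Cauchy_limit[OF si this] obtain f where f: "square_integrable M f"
    and lim: "\<And>e. e > 0 \<Longrightarrow> \<exists>N. \<forall>i\<ge>N. norm2 M (\<lambda>x. f x - s i x) \<le> e" by blast
  have "f \<in> S"
  proof (rule closed[OF f])
    fix e :: real assume "e > 0"
    then obtain N where "norm2 M (\<lambda>x. f x - s N x) \<le> e" using lim by blast
    then show "\<exists>g\<in>S. norm2 M (\<lambda>x. f x - g x) \<le> e" using s(1) by blast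
  qed
  moreover have "norm2 M f \<le> norm2 M g" if g: "g \<in> S" for g
  proof (rule field_le_epsilon)
    fix e :: real assume e: "0 < e"
    obtain N where N: "\<forall>i\<ge>N. norm2 M (\<lambda>x. f x - s i x) \<le> e/2" using lim[of "e/2"] e by auto
    obtain K where K: "1 / real (Suc K) < (e/2)\<^sup>2" using ex_divide_Suc_less[of "(e/2)\<^sup>2" 1] e by auto
    define i where "i = max N K"
    have "1 / real (Suc i) \<le> 1 / real (Suc K)"
      unfolding i_def by (intro divide_left_mono) auto
    then have "(norm2 M (s i))\<^sup>2 \<le> (norm2 M g)\<^sup>2 + (e/2)\<^sup>2"
      using s(2)[of i] lower[OF g] K by linarith
    also have "\<dots> \<le> (norm2 M g + e/2)\<^sup>2" using e by (simp add: power2_sum)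
    finally have "norm2 M (s i) \<le> norm2 M g + e/2"
      by (rule power2_le_imp_le) (use e in simp)
    moreover have "norm2 M (\<lambda>x. f x - s i x) \<le> e/2" using N by (simp add: i_def)
    moreover have "norm2 M f \<le> norm2 M (\<lambda>x. f x - s i x) + norm2 M (s i)"
      using norm2_triangle[OF square_integrable_diff[OF f si[of i]] si[of i]] by simp
    ultimately show "norm2 M f \<le> norm2 M g + e" by linarith
  qed
  ultimately show ?thesis by blast
qed

section \<open>Plans and the Wasserstein distance\<close>

lemma measurable_fst_borel [measurable]:
  "fst \<in> borel_measurable (borel :: ('a::second_countable_topology \<times> 'b::second_countable_topology) measure)"
  by (metis borel_prod measurable_fst)

lemma measurable_snd_borel [measurable]:
  "snd \<in> borel_measurable (borel :: ('a::second_countable_topology \<times> 'b::second_countable_topology) measure)"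
  by (metis borel_prod measurable_snd)

lemma P2_iff:
  "\<mu> \<in> P2 \<longleftrightarrow> sets \<mu> = sets borel \<and> prob_space \<mu> \<and> square_integrable \<mu> (\<lambda>x. x)"
proof -
  have "(\<lambda>x. x) \<in> borel_measurable \<mu>" if "sets \<mu> = sets borel"
    using that by (subst measurable_cong_sets[OF that refl]) simp
  then show ?thesis by (auto simp: P2_def square_integrable_def)
qed

lemma P2D:
  assumes "\<mu> \<in> P2"
  shows "sets \<mu> = sets borel" "prob_space \<mu>" "square_integrable \<mu> (\<lambda>x. x)"
  using assms by (simp_all add: P2_iff)

lemma L2_iff: "\<xi> \<in> L2 \<mu> \<longleftrightarrow> square_integrable \<mu> \<xi>"
  by (simp add: L2_def square_integrable_def)

lemma L2_norm_eq: "L2_norm \<mu> = norm2 \<mu>"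
  by (simp add: fun_eq_iff L2_norm_def norm2_def)

lemma sqrt_transport_cost: "sqrt (transport_cost \<gamma>) = norm2 \<gamma> (\<lambda>z. snd z - fst z)"
  by (simp add: transport_cost_def norm2_def norm_minus_commute)

lemma transport_cost_eq: "transport_cost \<gamma> = (norm2 \<gamma> (\<lambda>z. snd z - fst z))\<^sup>2"
  by (simp add: transport_cost_def norm2_def norm_minus_commute)

text \<open>
  All plans below arise as joint laws of two random variables; finiteness of the second moment is inherited
  from the marginals.
\<close>

lemma plansI_coupling:
  fixes \<mu> \<nu> :: "'a::euclidean_space measure"
  assumes M: "prob_space M" and X [measurable]: "X \<in> borel_measurable M" and Y [measurable]: "Y \<in> borel_measurable M"
    and \<mu>: "distr M borel X = \<mu>" "\<mu> \<in> P2" and \<nu>: "distr M borel Y = \<nu>" "\<nu> \<in> P2"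
  shows "distr M borel (\<lambda>\<omega>. (X \<omega>, Y \<omega>)) \<in> plans \<mu> \<nu>"
proof -
  have XY: "square_integrable M X" "square_integrable M Y"
    using P2D(3)[OF \<mu>(2)] P2D(3)[OF \<nu>(2)]
    unfolding \<mu>(1)[symmetric] \<nu>(1)[symmetric] by (simp_all add: square_integrable_distr)
  then have "integrable M (\<lambda>\<omega>. (norm (X \<omega>, Y \<omega>))\<^sup>2)"
    by (simp add: square_integrable_def norm_Pair)
  then have "distr M borel (\<lambda>\<omega>. (X \<omega>, Y \<omega>)) \<in> P2"
    by (auto simp: P2_iff square_integrable_distr square_integrable_def integrable_distr_eq
        intro!: prob_space.prob_space_distr[OF M])
  moreover have "distr (distr M borel (\<lambda>\<omega>. (X \<omega>, Y \<omega>))) borel fst = \<mu>"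
    "distr (distr M borel (\<lambda>\<omega>. (X \<omega>, Y \<omega>))) borel snd = \<nu>"
    using \<mu>(1) \<nu>(1) by (simp_all add: distr_distr comp_def)
  ultimately show ?thesis by (simp add: plans_def)
qed

lemma plansD:
  assumes \<gamma>: "\<gamma> \<in> plans \<mu> \<nu>"
  shows "prob_space \<gamma>" "sets \<gamma> = sets borel" "distr \<gamma> borel fst = \<mu>" "distr \<gamma> borel snd = \<nu>"
    "fst \<in> borel_measurable \<gamma>" "snd \<in> borel_measurable \<gamma>"
    "square_integrable \<gamma> fst" "square_integrable \<gamma> snd"
proof -
  show s: "prob_space \<gamma>" "sets \<gamma> = sets borel" "distr \<gamma> borel fst = \<mu>" "distr \<gamma> borel snd = \<nu>"
    using \<gamma> by (auto simp: plans_def P2_iff)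
  show m: "fst \<in> borel_measurable \<gamma>" "snd \<in> borel_measurable \<gamma>"
    by (simp_all add: measurable_cong_sets[OF s(2) refl])
  have int: "integrable \<gamma> (\<lambda>x. (norm x)\<^sup>2)" using \<gamma> by (auto simp: plans_def P2_def)
  have n: "(norm z)\<^sup>2 = (norm (fst z))\<^sup>2 + (norm (snd z))\<^sup>2" for z :: "'a \<times> 'a"
    by (cases z) (simp add: norm_Pair)
  have "integrable \<gamma> (\<lambda>x. (norm (fst x))\<^sup>2)"
    by (rule Bochner_Integration.integrable_bound[OF int]) (use m in \<open>auto simp: n\<close>)
  moreover have "integrable \<gamma> (\<lambda>x. (norm (snd x))\<^sup>2)"
    by (rule Bochner_Integration.integrable_bound[OF int]) (use m in \<open>auto simp: n\<close>)
  ultimately show "square_integrable \<gamma> fst" "square_integrable \<gamma> snd"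
    using m by (simp_all add: square_integrable_def)
qed

lemma plans_P2:
  assumes "\<gamma> \<in> plans \<mu> \<nu>"
  shows "\<mu> \<in> P2" "\<nu> \<in> P2"
  using plansD[OF assms]
  by (auto simp: P2_iff square_integrable_distr dest!: sym[of "distr _ _ _"]
      intro!: prob_space.prob_space_distr)

lemma plans_displacement:
  assumes "\<gamma> \<in> plans \<mu> \<nu>"
  shows "square_integrable \<gamma> (\<lambda>z. snd z - fst z)"
  using plansD(7,8)[OF assms] by (simp add: square_integrable_diff)

lemma plans_fst:
  assumes "\<gamma> \<in> plans \<mu> \<nu>" "square_integrable \<mu> \<xi>"
  shows "square_integrable \<gamma> (\<lambda>z. \<xi> (fst z))" "norm2 \<gamma> (\<lambda>z. \<xi> (fst z)) = norm2 \<mu> \<xi>"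
proof -
  note p = plansD[OF assms(1)]
  have "sets \<mu> = sets borel" using p(3) by (metis sets_distr)
  then have m: "\<xi> \<in> borel_measurable borel"
    using square_integrable_measurable[OF assms(2)] measurable_cong_sets by blast
  show "square_integrable \<gamma> (\<lambda>z. \<xi> (fst z))" "norm2 \<gamma> (\<lambda>z. \<xi> (fst z)) = norm2 \<mu> \<xi>"
    using assms(2) square_integrable_distr[OF p(5) m] norm2_distr[OF p(5) m] by (simp_all add: p(3))
qed

lemma plans_snd:
  assumes "\<gamma> \<in> plans \<mu> \<nu>" "square_integrable \<nu> \<xi>"
  shows "square_integrable \<gamma> (\<lambda>z. \<xi> (snd z))" "norm2 \<gamma> (\<lambda>z. \<xi> (snd z)) = norm2 \<nu> \<xi>"
proof -
  note p = plansD[OF assms(1)]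
  have "sets \<nu> = sets borel" using p(4) by (metis sets_distr)
  then have m: "\<xi> \<in> borel_measurable borel"
    using square_integrable_measurable[OF assms(2)] measurable_cong_sets by blast
  show "square_integrable \<gamma> (\<lambda>z. \<xi> (snd z))" "norm2 \<gamma> (\<lambda>z. \<xi> (snd z)) = norm2 \<nu> \<xi>"
    using assms(2) square_integrable_distr[OF p(6) m] norm2_distr[OF p(6) m] by (simp_all add: p(4))
qed

lemma plans_pair_measure:
  assumes "\<mu> \<in> P2" "\<nu> \<in> P2"
  shows "plans \<mu> \<nu> \<noteq> {}"
proof -
  interpret \<mu>: prob_space \<mu> by (rule P2D(2)[OF assms(1)])
  interpret \<nu>: prob_space \<nu> by (rule P2D(2)[OF assms(2)])
  interpret pair_prob_space \<mu> \<nu> ..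
  have f: "fst \<in> measurable (\<mu> \<Otimes>\<^sub>M \<nu>) borel" "snd \<in> measurable (\<mu> \<Otimes>\<^sub>M \<nu>) borel"
    using measurable_fst[of \<mu> \<nu>] measurable_snd[of \<mu> \<nu>] P2D(1)[OF assms(1)] P2D(1)[OF assms(2)]
    by (metis measurable_cong_sets)+
  have d1: "distr (\<mu> \<Otimes>\<^sub>M \<nu>) borel fst = \<mu>"
  proof (rule measure_eqI)
    fix A assume "A \<in> sets (distr (\<mu> \<Otimes>\<^sub>M \<nu>) borel fst)"
    then have A: "A \<in> sets \<mu>" "A \<in> sets borel" using P2D(1)[OF assms(1)] by auto
    have "fst -` A \<inter> space (\<mu> \<Otimes>\<^sub>M \<nu>) = A \<times> space \<nu>"
      using sets.sets_into_space[OF A(1)] by (auto simp: space_pair_measure)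
    then show "emeasure (distr (\<mu> \<Otimes>\<^sub>M \<nu>) borel fst) A = emeasure \<mu> A"
      using A f by (simp add: emeasure_distr \<nu>.emeasure_pair_measure_Times \<nu>.emeasure_space_1)
  qed (simp add: P2D(1)[OF assms(1)])
  have d2: "distr (\<mu> \<Otimes>\<^sub>M \<nu>) borel snd = \<nu>"
  proof (rule measure_eqI)
    fix A assume "A \<in> sets (distr (\<mu> \<Otimes>\<^sub>M \<nu>) borel snd)"
    then have A: "A \<in> sets \<nu>" "A \<in> sets borel" using P2D(1)[OF assms(2)] by auto
    have "snd -` A \<inter> space (\<mu> \<Otimes>\<^sub>M \<nu>) = space \<mu> \<times> A"
      using sets.sets_into_space[OF A(1)] by (auto simp: space_pair_measure)
    then show "emeasure (distr (\<mu> \<Otimes>\<^sub>M \<nu>) borel snd) A = emeasure \<nu> A"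
      using A f by (simp add: emeasure_distr \<nu>.emeasure_pair_measure_Times \<mu>.emeasure_space_1)
  qed (simp add: P2D(1)[OF assms(2)])
  show ?thesis
    using plansI_coupling[OF prob_space_axioms f d1 assms(1) d2 assms(2)] by blast
qed

lemma W2_le:
  assumes "\<gamma> \<in> plans \<mu> \<nu>"
  shows "W2 \<mu> \<nu> \<le> norm2 \<gamma> (\<lambda>z. snd z - fst z)"
  unfolding W2_def sqrt_transport_cost
  by (rule cINF_lower[OF _ assms]) (auto intro: bdd_belowI[of _ 0])

lemma W2_greatest:
  assumes "\<mu> \<in> P2" "\<nu> \<in> P2"
    and "\<And>\<gamma>. \<gamma> \<in> plans \<mu> \<nu> \<Longrightarrow> c \<le> norm2 \<gamma> (\<lambda>z. snd z - fst z)"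
  shows "c \<le> W2 \<mu> \<nu>"
  unfolding W2_def sqrt_transport_cost
  using plans_pair_measure[OF assms(1,2)] assms(3) by (rule cINF_greatest)

lemma W2_nonneg: "\<mu> \<in> P2 \<Longrightarrow> \<nu> \<in> P2 \<Longrightarrow> 0 \<le> W2 \<mu> \<nu>"
  by (rule W2_greatest) simp_all

lemma W2_approx:
  assumes "\<mu> \<in> P2" "\<nu> \<in> P2" "e > 0"
  obtains \<gamma> where "\<gamma> \<in> plans \<mu> \<nu>" "norm2 \<gamma> (\<lambda>z. snd z - fst z) < W2 \<mu> \<nu> + e"
  using W2_greatest[OF assms(1,2), of "W2 \<mu> \<nu> + e"] assms(3) by force

lemma optimal_plans_iff:
  "\<gamma> \<in> optimal_plans \<mu> \<nu> \<longleftrightarrow> \<gamma> \<in> plans \<mu> \<nu> \<and> norm2 \<gamma> (\<lambda>z. snd z - fst z) = W2 \<mu> \<nu>"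
  using W2_nonneg[of \<mu> \<nu>] plans_P2[of \<gamma> \<mu> \<nu>]
  by (auto simp: optimal_plans_def transport_cost_eq)

lemma W2_le_coupling:
  fixes \<mu> \<nu> :: "'a::euclidean_space measure"
  assumes M: "prob_space M" and X [measurable]: "X \<in> borel_measurable M" and Y [measurable]: "Y \<in> borel_measurable M"
    and \<mu>: "distr M borel X = \<mu>" "\<mu> \<in> P2" and \<nu>: "distr M borel Y = \<nu>" "\<nu> \<in> P2"
  shows "W2 \<mu> \<nu> \<le> norm2 M (\<lambda>\<omega>. Y \<omega> - X \<omega>)"
  using W2_le[OF plansI_coupling[OF assms]] by (simp add: norm2_distr)

lemma swap_plans:
  assumes \<gamma>: "\<gamma> \<in> plans \<mu> \<nu>"
  shows "distr \<gamma> borel prod.swap \<in> plans \<nu> \<mu>"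
proof -
  note p = plansD[OF \<gamma>]
  have "prod.swap = (\<lambda>z::'a \<times> 'a. (snd z, fst z))" by auto
  then show ?thesis
    using plansI_coupling[OF p(1) p(6) p(5) p(4) _ p(3)] plans_P2[OF \<gamma>] by simp
qed

lemma swap_measurable:
  fixes \<gamma> :: "('a::euclidean_space \<times> 'a) measure"
  assumes "\<gamma> \<in> plans \<mu> \<nu>"
  shows "prod.swap \<in> borel_measurable \<gamma>"
proof -
  note [measurable] = plansD(5,6)[OF assms]
  have sw: "prod.swap = (\<lambda>z::'a \<times> 'a. (snd z, fst z))" by auto
  show ?thesis unfolding sw by measurable
qed

lemma norm2_swap:
  fixes \<gamma> :: "('a::euclidean_space \<times> 'a) measure"
  assumes \<gamma>: "\<gamma> \<in> plans \<mu> \<nu>"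
  shows "norm2 (distr \<gamma> borel prod.swap) (\<lambda>z. snd z - fst z) = norm2 \<gamma> (\<lambda>z. snd z - fst z)"
  by (subst norm2_distr) (simp_all add: swap_measurable[OF \<gamma>] norm2_diff_commute[of _ fst])

lemma W2_commute:
  assumes "\<mu> \<in> P2" "\<nu> \<in> P2"
  shows "W2 \<mu> \<nu> = W2 \<nu> \<mu>"
proof (rule antisym)
  show "W2 \<mu> \<nu> \<le> W2 \<nu> \<mu>"
    using W2_le[OF swap_plans] norm2_swap by (intro W2_greatest assms) fastforce
  show "W2 \<nu> \<mu> \<le> W2 \<mu> \<nu>"
    using W2_le[OF swap_plans] norm2_swap by (intro W2_greatest assms) fastforce
qed

lemma swap_optimal_plans:
  assumes "\<gamma> \<in> optimal_plans \<mu> \<nu>"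
  shows "distr \<gamma> borel prod.swap \<in> optimal_plans \<nu> \<mu>"
  using assms swap_plans norm2_swap W2_commute plans_P2 unfolding optimal_plans_iff by metis

section \<open>Approximate gluing, the triangle inequality and aligned plans\<close>

text \<open>
  Conditioning on a discrete variable is elementary: given the common value \<open>n\<close> of \<open>X\<close> and \<open>Y\<close>, the two
  points are drawn independently from \<open>M\<close> conditioned on \<open>X = n\<close> and from \<open>N\<close> conditioned on \<open>Y = n\<close>. The
  resulting law has the density \<open>1 / P(X = n)\<close> on \<open>{X = Y = n}\<close> with respect to the product.
\<close>

lemma gluing_along_discrete_variable:
  fixes X :: "'a \<Rightarrow> nat" and Y :: "'b \<Rightarrow> nat"
  assumes M: "prob_space M" and N: "prob_space N"
    and X [measurable]: "X \<in> measurable M (count_space UNIV)"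
    and Y [measurable]: "Y \<in> measurable N (count_space UNIV)"
    and eq: "distr M (count_space UNIV) X = distr N (count_space UNIV) Y"
  obtains \<pi> where "prob_space \<pi>" "sets \<pi> = sets (M \<Otimes>\<^sub>M N)"
    "distr \<pi> M fst = M" "distr \<pi> N snd = N" "AE z in \<pi>. X (fst z) = Y (snd z)"
proof -
  interpret M: prob_space M by fact
  interpret N: prob_space N by fact
  interpret pair_prob_space M N ..
  define p where "p n = emeasure M (X -` {n} \<inter> space M)" for n
  have pN: "p n = emeasure N (Y -` {n} \<inter> space N)" for n
  proof -
    have "p n = emeasure (distr M (count_space UNIV) X) {n}" by (simp add: p_def emeasure_distr)
    then show ?thesis by (simp add: eq emeasure_distr)
  qed
  have pfin: "p n \<noteq> \<infinity>" for n by (simp add: p_def)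
  define g where "g z = (if X (fst z) = Y (snd z) then inverse (p (X (fst z))) else 0)" for z
  have [measurable]: "g \<in> borel_measurable (M \<Otimes>\<^sub>M N)"
  proof -
    have "(\<lambda>z. inverse (p (X (fst z)))) \<in> borel_measurable (M \<Otimes>\<^sub>M N)"
      by (rule measurable_compose[OF measurable_compose[OF measurable_fst X]]) simp
    moreover have "{z \<in> space (M \<Otimes>\<^sub>M N). X (fst z) = Y (snd z)}
        = (\<Union>n. (X -` {n} \<inter> space M) \<times> (Y -` {n} \<inter> space N))"
      by (auto simp: space_pair_measure)
    moreover have "(\<Union>n. (X -` {n} \<inter> space M) \<times> (Y -` {n} \<inter> space N)) \<in> sets (M \<Otimes>\<^sub>M N)"
      by (intro sets.countable_UN pair_measureI image_subsetI measurable_sets[OF X] measurable_sets[OF Y]) auto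
    ultimately show ?thesis
      unfolding g_def by (intro measurable_If) simp_all
  qed
  have one: "inverse (p n) * p n = 1" if "p n \<noteq> 0" for n
    using that pfin[of n] ennreal_divide_self[of "p n"] by (simp add: divide_ennreal_def less_top mult.commute)
  \<comment> \<open>The convention \<open>inverse 0 = \<infinity>\<close> is harmless: values of probability zero are almost surely not taken.\<close>
  have AEM: "AE x in M. p (X x) \<noteq> 0"
  proof -
    have "AE x in M. p n = 0 \<longrightarrow> X x \<noteq> n" for n
    proof (cases "p n = 0")
      case True
      have "AE x in M. x \<notin> X -` {n} \<inter> space M"
        using True by (intro AE_not_in) (auto simp: p_def null_sets_def)
      then show ?thesis by (rule AE_mp) (simp add: AE_I2)
    qed simp
    then have "AE x in M. \<forall>n. p n = 0 \<longrightarrow> X x \<noteq> n" by (simp add: AE_all_countable)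
    then show ?thesis by eventually_elim auto
  qed
  have AEN: "AE y in N. p (Y y) \<noteq> 0"
  proof -
    have "AE y in N. p n = 0 \<longrightarrow> Y y \<noteq> n" for n
    proof (cases "p n = 0")
      case True
      have "AE y in N. y \<notin> Y -` {n} \<inter> space N"
        using True by (intro AE_not_in) (auto simp: pN null_sets_def)
      then show ?thesis by (rule AE_mp) (simp add: AE_I2)
    qed simp
    then have "AE y in N. \<forall>n. p n = 0 \<longrightarrow> Y y \<noteq> n" by (simp add: AE_all_countable)
    then show ?thesis by eventually_elim auto
  qed
  define \<pi> where "\<pi> = density (M \<Otimes>\<^sub>M N) g"
  have s: "sets \<pi> = sets (M \<Otimes>\<^sub>M N)" "space \<pi> = space (M \<Otimes>\<^sub>M N)" by (simp_all add: \<pi>_def)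
  have mf [measurable]: "fst \<in> measurable \<pi> M" "snd \<in> measurable \<pi> N"
    by (simp_all add: \<pi>_def)
  have d1: "distr \<pi> M fst = M"
  proof (rule measure_eqI)
    fix A assume "A \<in> sets (distr \<pi> M fst)"
    then have A [measurable]: "A \<in> sets M" by simp
    have "fst -` A \<inter> space \<pi> = A \<times> space N"
      using sets.sets_into_space[OF A] by (auto simp: s space_pair_measure)
    then have "emeasure (distr \<pi> M fst) A = emeasure \<pi> (A \<times> space N)"
      by (simp add: emeasure_distr)
    also have "\<dots> = (\<integral>\<^sup>+z. g z * indicator (A \<times> space N) z \<partial>(M \<Otimes>\<^sub>M N))"
      unfolding \<pi>_def by (rule emeasure_density) auto
    also have "\<dots> = (\<integral>\<^sup>+x. \<integral>\<^sup>+y. g (x, y) * indicator (A \<times> space N) (x, y) \<partial>N \<partial>M)"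
      by (rule N.nn_integral_fst[symmetric]) measurable
    also have "\<dots> = (\<integral>\<^sup>+x. indicator A x \<partial>M)"
    proof (rule nn_integral_cong_AE)
      show "AE x in M. (\<integral>\<^sup>+y. g (x, y) * indicator (A \<times> space N) (x, y) \<partial>N) = indicator A x"
        using AEM
      proof eventually_elim
        case (elim x)
        have "(\<integral>\<^sup>+y. g (x, y) * indicator (A \<times> space N) (x, y) \<partial>N)
            = (\<integral>\<^sup>+y. (inverse (p (X x)) * indicator A x) * indicator (Y -` {X x} \<inter> space N) y \<partial>N)"
          by (rule nn_integral_cong) (auto simp: g_def indicator_def)
        also have "\<dots> = inverse (p (X x)) * indicator A x * p (X x)"
          by (subst nn_integral_cmult_indicator) (simp_all add: pN)
        also have "\<dots> = indicator A x" using one[OF elim] by (simp add: indicator_def)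
        finally show ?case .
      qed
    qed
    also have "\<dots> = emeasure M A" by simp
    finally show "emeasure (distr \<pi> M fst) A = emeasure M A" .
  qed simp
  have d2: "distr \<pi> N snd = N"
  proof (rule measure_eqI)
    fix A assume "A \<in> sets (distr \<pi> N snd)"
    then have A [measurable]: "A \<in> sets N" by simp
    have "snd -` A \<inter> space \<pi> = space M \<times> A"
      using sets.sets_into_space[OF A] by (auto simp: s space_pair_measure)
    then have "emeasure (distr \<pi> N snd) A = emeasure \<pi> (space M \<times> A)"
      by (simp add: emeasure_distr)
    also have "\<dots> = (\<integral>\<^sup>+z. g z * indicator (space M \<times> A) z \<partial>(M \<Otimes>\<^sub>M N))"
      unfolding \<pi>_def by (rule emeasure_density) auto
    also have "\<dots> = (\<integral>\<^sup>+y. \<integral>\<^sup>+x. g (x, y) * indicator (space M \<times> A) (x, y) \<partial>M \<partial>N)"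
      by (rule nn_integral_snd[symmetric]) measurable
    also have "\<dots> = (\<integral>\<^sup>+y. indicator A y \<partial>N)"
    proof (rule nn_integral_cong_AE)
      show "AE y in N. (\<integral>\<^sup>+x. g (x, y) * indicator (space M \<times> A) (x, y) \<partial>M) = indicator A y"
        using AEN
      proof eventually_elim
        case (elim y)
        have "(\<integral>\<^sup>+x. g (x, y) * indicator (space M \<times> A) (x, y) \<partial>M)
            = (\<integral>\<^sup>+x. (inverse (p (Y y)) * indicator A y) * indicator (X -` {Y y} \<inter> space M) x \<partial>M)"
          by (rule nn_integral_cong) (auto simp: g_def indicator_def)
        also have "\<dots> = inverse (p (Y y)) * indicator A y * p (Y y)"
          by (subst nn_integral_cmult_indicator) (simp_all add: p_def)
        also have "\<dots> = indicator A y" using one[OF elim] by (simp add: indicator_def)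
        finally show ?case .
      qed
    qed
    also have "\<dots> = emeasure N A" by simp
    finally show "emeasure (distr \<pi> N snd) A = emeasure N A" .
  qed simp
  have "prob_space \<pi>"
  proof
    have "emeasure \<pi> (space \<pi>) = emeasure (distr \<pi> M fst) (space M)"
      using measurable_space[OF mf(1)] by (subst emeasure_distr) (auto intro!: arg_cong[where f = "emeasure \<pi>"])
    then show "emeasure \<pi> (space \<pi>) = 1" by (simp add: d1 M.emeasure_space_1)
  qed
  moreover have "AE z in \<pi>. X (fst z) = Y (snd z)"
    unfolding \<pi>_def by (subst AE_density) (auto simp: g_def intro!: AE_I2)
  ultimately show thesis using that s(1) d1 d2 by blast
qed

lemma countable_fine_partition:
  fixes e :: real
  assumes "e > 0"
  obtains k :: "'a::{metric_space, second_countable_topology} \<Rightarrow> nat"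
  where "k \<in> measurable borel (count_space UNIV)" "\<And>x y. k x = k y \<Longrightarrow> dist x y < e"
proof -
  obtain D :: "'a set" where D: "countable D" "\<And>X. open X \<Longrightarrow> X \<noteq> {} \<Longrightarrow> \<exists>d\<in>D. d \<in> X"
    by (erule countable_dense_setE)
  define d where "d = from_nat_into D"
  define k where "k x = (LEAST n. dist x (d n) < e / 2)" for x
  have "\<exists>n. dist x (d n) < e / 2" for x
  proof -
    obtain y where y: "y \<in> D" "y \<in> ball x (e / 2)" using D(2)[of "ball x (e / 2)"] assms by auto
    then obtain n where "y = d n" unfolding d_def using D(1) by (metis from_nat_into_surj)
    then show ?thesis using y by auto
  qed
  then have k: "dist x (d (k x)) < e / 2" for x
    unfolding k_def by (rule LeastI_ex)
  show thesis
  proof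
    show "k \<in> measurable borel (count_space UNIV)"
      unfolding k_def by measurable
    show "dist x y < e" if "k x = k y" for x y
      using k[of x] k[of y] that dist_triangle2[of x y "d (k x)"] by simp
  qed
qed

text \<open>
  The cells of the partition are cut out of the graph of \<open>\<xi>\<close>, so that not only the two copies of the middle point
  but also the values of \<open>\<xi>\<close> there are close. This avoids any approximation of \<open>\<xi>\<close> by continuous functions.
\<close>

lemma approximate_gluing:
  fixes \<alpha> \<beta> :: "('a::euclidean_space \<times> 'a) measure" and \<xi> :: "'a \<Rightarrow> 'a"
  assumes \<alpha>: "\<alpha> \<in> plans \<mu> \<nu>" and \<beta>: "\<beta> \<in> plans \<nu> \<rho>"
    and \<xi> [measurable]: "\<xi> \<in> borel_measurable borel" and e: "e > 0"
  obtains \<pi> where "prob_space \<pi>" "fst \<in> borel_measurable \<pi>" "snd \<in> borel_measurable \<pi>"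
    "distr \<pi> borel fst = \<alpha>" "distr \<pi> borel snd = \<beta>"
    "AE z in \<pi>. norm (fst (snd z) - snd (fst z)) \<le> e"
    "AE z in \<pi>. norm (\<xi> (fst (snd z)) - \<xi> (snd (fst z))) \<le> e"
proof -
  note a = plansD[OF \<alpha>] and b = plansD[OF \<beta>]
  note [measurable] = a(6) b(5)
  obtain k :: "'a \<times> 'a \<Rightarrow> nat" where k [measurable]: "k \<in> measurable borel (count_space UNIV)"
    and fine: "\<And>x y. k x = k y \<Longrightarrow> dist x y < e"
    using countable_fine_partition[OF e] by metis
  define h where "h y = k (y, \<xi> y)" for y
  have h [measurable]: "h \<in> measurable borel (count_space UNIV)" unfolding h_def by measurable
  have "distr \<alpha> (count_space UNIV) (\<lambda>z. h (snd z)) = distr (distr \<alpha> borel snd) (count_space UNIV) h"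
    by (simp add: distr_distr comp_def)
  also have "\<dots> = distr (distr \<beta> borel fst) (count_space UNIV) h" by (simp add: a(4) b(3))
  also have "\<dots> = distr \<beta> (count_space UNIV) (\<lambda>z. h (fst z))"
    by (simp add: distr_distr comp_def)
  finally have eq: "distr \<alpha> (count_space UNIV) (\<lambda>z. h (snd z)) = distr \<beta> (count_space UNIV) (\<lambda>z. h (fst z))" .
  obtain \<pi> where \<pi>: "prob_space \<pi>" "sets \<pi> = sets (\<alpha> \<Otimes>\<^sub>M \<beta>)"
    "distr \<pi> \<alpha> fst = \<alpha>" "distr \<pi> \<beta> snd = \<beta>" "AE z in \<pi>. h (snd (fst z)) = h (fst (snd z))"
    by (rule gluing_along_discrete_variable[OF a(1) b(1) _ _ eq]) measurable
  have m: "fst \<in> borel_measurable \<pi>" "snd \<in> borel_measurable \<pi>"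
    using measurable_fst[of \<alpha> \<beta>] measurable_snd[of \<alpha> \<beta>] \<pi>(2) a(2) b(2)
    by (metis measurable_cong_sets)+
  have close: "norm (fst w - fst v) \<le> e \<and> norm (snd w - snd v) \<le> e" if "dist v w < e" for v w :: "'a \<times> 'a"
    using that dist_fst_le[of w v] dist_snd_le[of w v] by (simp add: dist_norm norm_minus_commute)
  show thesis
  proof
    show "prob_space \<pi>" "fst \<in> borel_measurable \<pi>" "snd \<in> borel_measurable \<pi>" by fact+
    show "distr \<pi> borel fst = \<alpha>" using \<pi>(3) distr_cong[OF refl a(2)[symmetric], of \<pi> fst fst] by simp
    show "distr \<pi> borel snd = \<beta>" using \<pi>(4) distr_cong[OF refl b(2)[symmetric], of \<pi> snd snd] by simp
    show "AE z in \<pi>. norm (fst (snd z) - snd (fst z)) \<le> e"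
      "AE z in \<pi>. norm (\<xi> (fst (snd z)) - \<xi> (snd (fst z))) \<le> e"
      using \<pi>(5) by (eventually_elim; use fine close in \<open>fastforce simp: h_def\<close>)+
  qed
qed

text \<open>
  The outer points of an approximate gluing are joined by the two displacements and a jump of size at most
  \<open>e\<close> inside a cell.
\<close>

lemma W2_le_glued:
  fixes \<alpha> \<beta> :: "('a::euclidean_space \<times> 'a) measure"
  assumes \<alpha>: "\<alpha> \<in> plans \<mu> \<nu>" and \<beta>: "\<beta> \<in> plans \<nu> \<rho>"
    and \<pi>: "prob_space \<pi>" and m [measurable]: "fst \<in> borel_measurable \<pi>" "snd \<in> borel_measurable \<pi>"
    and d: "distr \<pi> borel fst = \<alpha>" "distr \<pi> borel snd = \<beta>"
    and close: "AE z in \<pi>. norm (fst (snd z) - snd (fst z)) \<le> e" and e: "0 < e"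
  shows "square_integrable \<pi> (\<lambda>z. snd (fst z) - fst (fst z))"
    "square_integrable \<pi> (\<lambda>z. snd (snd z) - fst (snd z))"
    "norm2 \<pi> (\<lambda>z. snd (fst z) - fst (fst z)) = norm2 \<alpha> (\<lambda>z. snd z - fst z)"
    "norm2 \<pi> (\<lambda>z. snd (snd z) - fst (snd z)) = norm2 \<beta> (\<lambda>z. snd z - fst z)"
    "W2 \<mu> \<rho> \<le> norm2 \<pi> (\<lambda>z. (snd (fst z) - fst (fst z)) + (snd (snd z) - fst (snd z))) + e"
proof -
  let ?A = "\<lambda>z::('a \<times> 'a) \<times> 'a \<times> 'a. snd (fst z) - fst (fst z)" and ?B = "\<lambda>z::('a \<times> 'a) \<times> 'a \<times> 'a. snd (snd z) - fst (snd z)"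
  show A: "square_integrable \<pi> ?A" and B: "square_integrable \<pi> ?B"
    using plans_displacement[OF \<alpha>] plans_displacement[OF \<beta>]
    unfolding d[symmetric] by (simp_all add: square_integrable_distr)
  show "norm2 \<pi> ?A = norm2 \<alpha> (\<lambda>z. snd z - fst z)" "norm2 \<pi> ?B = norm2 \<beta> (\<lambda>z. snd z - fst z)"
    unfolding d[symmetric] by (simp_all add: norm2_distr)
  have E: "square_integrable \<pi> (\<lambda>z. fst (snd z) - snd (fst z))"
    "norm2 \<pi> (\<lambda>z. fst (snd z) - snd (fst z)) \<le> e"
    using close e by (auto intro!: prob_space.norm2_le_bound[OF \<pi>])
  have "distr \<pi> borel (\<lambda>z. fst (fst z)) = distr (distr \<pi> borel fst) borel fst"
    "distr \<pi> borel (\<lambda>z. snd (snd z)) = distr (distr \<pi> borel snd) borel snd"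
    by (simp_all add: distr_distr comp_def)
  then have "W2 \<mu> \<rho> \<le> norm2 \<pi> (\<lambda>z. snd (snd z) - fst (fst z))"
    using plansD(3)[OF \<alpha>] plansD(4)[OF \<beta>] plans_P2[OF \<alpha>] plans_P2[OF \<beta>]
    by (intro W2_le_coupling[OF \<pi>]) (simp_all add: d)
  also have "\<dots> = norm2 \<pi> (\<lambda>z. (?A z + ?B z) + (fst (snd z) - snd (fst z)))"
    by (simp add: algebra_simps)
  also have "\<dots> \<le> norm2 \<pi> (\<lambda>z. ?A z + ?B z) + norm2 \<pi> (\<lambda>z. fst (snd z) - snd (fst z))"
    by (rule norm2_triangle[OF square_integrable_add[OF A B] E(1)])
  also have "\<dots> \<le> norm2 \<pi> (\<lambda>z. ?A z + ?B z) + e" using E(2) by simp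
  finally show "W2 \<mu> \<rho> \<le> norm2 \<pi> (\<lambda>z. ?A z + ?B z) + e" .
qed

lemma W2_triangle:
  fixes \<mu> \<nu> \<rho> :: "'a::euclidean_space measure"
  assumes P: "\<mu> \<in> P2" "\<nu> \<in> P2" "\<rho> \<in> P2"
  shows "W2 \<mu> \<rho> \<le> W2 \<mu> \<nu> + W2 \<nu> \<rho>"
proof (rule field_le_epsilon)
  fix e :: real assume "0 < e"
  then have e: "0 < e / 3" by simp
  obtain \<alpha> where \<alpha>: "\<alpha> \<in> plans \<mu> \<nu>" "norm2 \<alpha> (\<lambda>z. snd z - fst z) < W2 \<mu> \<nu> + e / 3"
    using W2_approx[OF P(1,2) e] by blast
  obtain \<beta> where \<beta>: "\<beta> \<in> plans \<nu> \<rho>" "norm2 \<beta> (\<lambda>z. snd z - fst z) < W2 \<nu> \<rho> + e / 3"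
    using W2_approx[OF P(2,3) e] by blast
  obtain \<pi> where \<pi>: "prob_space \<pi>" "fst \<in> borel_measurable \<pi>" "snd \<in> borel_measurable \<pi>"
    "distr \<pi> borel fst = \<alpha>" "distr \<pi> borel snd = \<beta>"
    "AE z in \<pi>. norm (fst (snd z) - snd (fst z)) \<le> e / 3"
    by (rule approximate_gluing[OF \<alpha>(1) \<beta>(1), of "\<lambda>x. x" "e / 3"]) (use e in auto)
  note g = W2_le_glued[OF \<alpha>(1) \<beta>(1) \<pi> e]
  from g(5) norm2_triangle[OF g(1,2)] \<alpha>(2) \<beta>(2)
  show "W2 \<mu> \<rho> \<le> W2 \<mu> \<nu> + W2 \<nu> \<rho> + e" unfolding g(3,4) by linarith
qed

text \<open>
  Let \<open>A\<close> and \<open>B\<close> be the displacements of \<open>\<alpha>\<close> and \<open>\<beta>\<close> on a gluing, with norms \<open>a\<close> and \<open>b\<close>. Since \<open>\<nu>\<close> lies between \<open>\<mu>\<close> and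
  \<open>\<rho>\<close>, the norm of \<open>A + B\<close> is at least \<open>a + b\<close> up to the gluing error, so equality nearly holds in the triangle
  inequality of \<open>L\<^sup>2\<close> and \<open>b A - a B\<close> is nearly zero. Testing this with \<open>\<xi>\<close> at the middle point gives the claim.
\<close>

lemma barycentre_of_aligned_plans:
  fixes \<mu> \<nu> \<rho> :: "'a::euclidean_space measure"
  assumes \<alpha>: "\<alpha> \<in> optimal_plans \<mu> \<nu>" and \<beta>: "\<beta> \<in> optimal_plans \<nu> \<rho>"
    and aligned: "W2 \<mu> \<rho> = W2 \<mu> \<nu> + W2 \<nu> \<rho>" and \<xi>: "\<xi> \<in> L2 \<nu>"
  shows "W2 \<nu> \<rho> * (\<integral>z. \<xi> (snd z) \<bullet> (snd z - fst z) \<partial>\<alpha>)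
    = W2 \<mu> \<nu> * (\<integral>z. \<xi> (fst z) \<bullet> (snd z - fst z) \<partial>\<beta>)"
proof -
  have \<alpha>p: "\<alpha> \<in> plans \<mu> \<nu>" and \<beta>p: "\<beta> \<in> plans \<nu> \<rho>"
    using \<alpha> \<beta> by (simp_all add: optimal_plans_iff)
  have \<xi>s: "square_integrable \<nu> \<xi>" using \<xi> by (simp add: L2_iff)
  have m\<xi> [measurable]: "\<xi> \<in> borel_measurable borel"
    using square_integrable_measurable[OF \<xi>s] P2D(1)[OF plans_P2(2)[OF \<alpha>p]] measurable_cong_sets by blast
  define a where "a = W2 \<mu> \<nu>"
  define b where "b = W2 \<nu> \<rho>"
  have ab: "0 \<le> a" "0 \<le> b"
    unfolding a_def b_def using plans_P2[OF \<alpha>p] plans_P2[OF \<beta>p] by (simp_all add: W2_nonneg)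
  define I where "I = (\<integral>z. \<xi> (snd z) \<bullet> (snd z - fst z) \<partial>\<alpha>)"
  define J where "J = (\<integral>z. \<xi> (fst z) \<bullet> (snd z - fst z) \<partial>\<beta>)"
  define c where "c = norm2 \<nu> \<xi>"
  have c: "0 \<le> c" by (simp add: c_def)
  have bound: "\<bar>b * I - a * J\<bar> \<le> c * sqrt (a * b * (2 * (a + b) * e + e\<^sup>2)) + a * b * e" if e: "0 < e" for e
  proof -
    obtain \<pi> where \<pi>: "prob_space \<pi>" "fst \<in> borel_measurable \<pi>" "snd \<in> borel_measurable \<pi>"
      "distr \<pi> borel fst = \<alpha>" "distr \<pi> borel snd = \<beta>"
      "AE z in \<pi>. norm (fst (snd z) - snd (fst z)) \<le> e"
      and close: "AE z in \<pi>. norm (\<xi> (fst (snd z)) - \<xi> (snd (fst z))) \<le> e"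
      by (rule approximate_gluing[OF \<alpha>p \<beta>p m\<xi> e])
    note [measurable] = \<pi>(2,3)
    let ?A = "\<lambda>z::('a \<times> 'a) \<times> 'a \<times> 'a. snd (fst z) - fst (fst z)"
    let ?B = "\<lambda>z::('a \<times> 'a) \<times> 'a \<times> 'a. snd (snd z) - fst (snd z)"
    let ?Y = "\<lambda>z::('a \<times> 'a) \<times> 'a \<times> 'a. \<xi> (snd (fst z))"
    let ?E = "\<lambda>z::('a \<times> 'a) \<times> 'a \<times> 'a. \<xi> (fst (snd z)) - \<xi> (snd (fst z))"
    note g = W2_le_glued[OF \<alpha>p \<beta>p \<pi> e]
    have nA: "norm2 \<pi> ?A = a" and nB: "norm2 \<pi> ?B = b"
      using g(3,4) \<alpha> \<beta> by (simp_all add: optimal_plans_iff a_def b_def)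
    have Y: "square_integrable \<pi> ?Y" "norm2 \<pi> ?Y = c"
      using plans_snd[OF \<alpha>p \<xi>s] unfolding \<pi>(4)[symmetric] c_def
      by (simp_all add: square_integrable_distr norm2_distr)
    have E: "square_integrable \<pi> ?E" "norm2 \<pi> ?E \<le> e"
      using close e by (auto intro!: prob_space.norm2_le_bound[OF \<pi>(1)])
    define s where "s = (\<integral>z. ?A z \<bullet> ?B z \<partial>\<pi>)"
    define D where "D z = b *\<^sub>R ?A z + (- a) *\<^sub>R ?B z" for z
    have D: "square_integrable \<pi> D"
      unfolding D_def by (intro square_integrable_add square_integrable_scaleR g(1,2))
    have "a + b \<le> norm2 \<pi> (\<lambda>z. ?A z + ?B z) + e"
      using g(5) aligned by (simp add: a_def b_def)
    \<comment> \<open>Squaring is done with \<open>e\<close> on the right, since \<open>a + b - e\<close> may be negative.\<close>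
    then have "(a + b)\<^sup>2 \<le> (norm2 \<pi> (\<lambda>z. ?A z + ?B z) + e)\<^sup>2"
      using ab by (intro power_mono) auto
    also have "\<dots> \<le> (norm2 \<pi> (\<lambda>z. ?A z + ?B z))\<^sup>2 + 2 * (a + b) * e + e\<^sup>2"
      using norm2_triangle[OF g(1,2)] e unfolding nA nB by (simp add: power2_sum)
    also have "(norm2 \<pi> (\<lambda>z. ?A z + ?B z))\<^sup>2 = a\<^sup>2 + 2 * s + b\<^sup>2"
      using norm2_lincomb_squared[OF g(1,2), of 1 1] by (simp add: nA nB s_def)
    finally have ss: "2 * a * b - 2 * s \<le> 2 * (a + b) * e + e\<^sup>2" by (simp add: power2_sum)
    have "(norm2 \<pi> D)\<^sup>2 = b\<^sup>2 * a\<^sup>2 - 2 * b * a * s + a\<^sup>2 * b\<^sup>2"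
      unfolding D_def norm2_lincomb_squared[OF g(1,2)] nA nB s_def by simp
    also have "\<dots> = a * b * (2 * a * b - 2 * s)" by (simp add: power2_eq_square algebra_simps)
    also have "\<dots> \<le> a * b * (2 * (a + b) * e + e\<^sup>2)"
      using ss ab by (intro mult_left_mono) auto
    finally have nD: "norm2 \<pi> D \<le> sqrt (a * b * (2 * (a + b) * e + e\<^sup>2))"
      by (rule real_le_rsqrt)
    have I: "I = (\<integral>z. ?Y z \<bullet> ?A z \<partial>\<pi>)"
      unfolding I_def \<pi>(4)[symmetric] by (subst integral_distr) simp_all
    have J: "J = (\<integral>z. (?Y z + ?E z) \<bullet> ?B z \<partial>\<pi>)"
      unfolding J_def \<pi>(5)[symmetric] by (subst integral_distr) simp_all
    have i: "integrable \<pi> (\<lambda>z. ?Y z \<bullet> ?A z)" "integrable \<pi> (\<lambda>z. ?Y z \<bullet> ?B z)" "integrable \<pi> (\<lambda>z. ?E z \<bullet> ?B z)"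
      by (intro square_integrable_inner Y(1) E(1) g(1,2))+
    have "(\<integral>z. ?Y z \<bullet> D z \<partial>\<pi>) = (\<integral>z. b * (?Y z \<bullet> ?A z) - a * (?Y z \<bullet> ?B z) \<partial>\<pi>)"
      by (rule Bochner_Integration.integral_cong) (simp_all add: D_def inner_diff_right)
    also have "\<dots> = b * I - a * (\<integral>z. ?Y z \<bullet> ?B z \<partial>\<pi>)" using i by (simp add: I)
    finally have YD: "(\<integral>z. ?Y z \<bullet> D z \<partial>\<pi>) = b * I - a * (\<integral>z. ?Y z \<bullet> ?B z \<partial>\<pi>)" .
    have "J = (\<integral>z. ?Y z \<bullet> ?B z + ?E z \<bullet> ?B z \<partial>\<pi>)"
      unfolding J by (rule Bochner_Integration.integral_cong) (simp_all only: inner_add_left)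
    also have "\<dots> = (\<integral>z. ?Y z \<bullet> ?B z \<partial>\<pi>) + (\<integral>z. ?E z \<bullet> ?B z \<partial>\<pi>)"
      by (rule Bochner_Integration.integral_add[OF i(2,3)])
    finally have "b * I - a * J = (\<integral>z. ?Y z \<bullet> D z \<partial>\<pi>) - a * (\<integral>z. ?E z \<bullet> ?B z \<partial>\<pi>)"
      unfolding YD by (simp add: algebra_simps)
    then have "\<bar>b * I - a * J\<bar> \<le> \<bar>\<integral>z. ?Y z \<bullet> D z \<partial>\<pi>\<bar> + a * \<bar>\<integral>z. ?E z \<bullet> ?B z \<partial>\<pi>\<bar>"
      using abs_triangle_ineq4[of "\<integral>z. ?Y z \<bullet> D z \<partial>\<pi>" "a * (\<integral>z. ?E z \<bullet> ?B z \<partial>\<pi>)"] ab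
      by (simp only: abs_mult abs_of_nonneg)
    moreover have "\<bar>\<integral>z. ?Y z \<bullet> D z \<partial>\<pi>\<bar> \<le> c * sqrt (a * b * (2 * (a + b) * e + e\<^sup>2))"
      using Cauchy_Schwarz_integral[OF Y(1) D] mult_left_mono[OF nD c] by (simp only: Y(2))
    moreover have "\<bar>\<integral>z. ?E z \<bullet> ?B z \<partial>\<pi>\<bar> \<le> e * b"
      using Cauchy_Schwarz_integral[OF E(1) g(2)] mult_right_mono[OF E(2) ab(2)] by (simp only: nB)
    then have "a * \<bar>\<integral>z. ?E z \<bullet> ?B z \<partial>\<pi>\<bar> \<le> a * b * e"
      using mult_left_mono[OF _ ab(1)] by (simp add: mult.assoc mult.commute[of e])
    ultimately show ?thesis by linarith
  qed
  have "((\<lambda>e. c * sqrt (a * b * (2 * (a + b) * e + e\<^sup>2)) + a * b * e) \<longlongrightarrow> 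
      c * sqrt (a * b * (2 * (a + b) * 0 + 0\<^sup>2)) + a * b * 0) (at_right 0)"
    by (intro tendsto_intros)
  moreover have "\<forall>\<^sub>F e in at_right 0. \<bar>b * I - a * J\<bar> \<le> c * sqrt (a * b * (2 * (a + b) * e + e\<^sup>2)) + a * b * e"
    using bound by (auto simp: eventually_at_right_field intro: exI[of _ 1])
  ultimately have "\<bar>b * I - a * J\<bar> \<le> c * sqrt (a * b * (2 * (a + b) * 0 + 0\<^sup>2)) + a * b * 0"
    by (rule tendsto_lowerbound) simp
  then show ?thesis by (simp add: a_def b_def I_def J_def)
qed

section \<open>Existence of optimal plans\<close>

text \<open>
  A sequence in the compact product of copies of \<open>[0, 1]\<close>, one for each set, has a cluster point. Passing to a filter
  replaces the choice of a subsequence, which need not exist for uncountably many sets.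
\<close>

lemma setwise_convergence_along_filter:
  fixes \<gamma> :: "nat \<Rightarrow> 'a measure"
  assumes prob: "\<And>n. prob_space (\<gamma> n)"
  obtains G f where "G \<le> sequentially" "G \<noteq> bot"
    "\<And>E. ((\<lambda>n. measure (\<gamma> n) E) \<longlongrightarrow> f E) G"
proof -
  define g where "g n = (\<lambda>E. measure (\<gamma> n) E)" for n
  define K :: "('a set \<Rightarrow> real) set" where "K = PiE UNIV (\<lambda>_. {0..1})"
  have "compactin (product_topology (\<lambda>_. euclidean) UNIV) K"
    unfolding K_def by (subst compactin_PiE) simp
  then have K: "compact K" by (simp add: euclidean_product_topology)
  have "g n \<in> K" for n
    using prob_space.prob_le_1[OF prob] by (auto simp: K_def g_def)
  then have "eventually (\<lambda>x. x \<in> K) (filtermap g sequentially)"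
    by (simp add: eventually_filtermap)
  then obtain f where f: "inf (nhds f) (filtermap g sequentially) \<noteq> bot"
    using K unfolding compact_filter by (metis filtermap_bot_iff trivial_limit_sequentially)
  define G where "G = inf sequentially (filtercomap g (nhds f))"
  have "G \<noteq> bot"
  proof
    assume "G = bot"
    then have "eventually (\<lambda>_. False) G" by simp
    then obtain P Q where P: "eventually P sequentially" and Q: "eventually Q (nhds f)"
      and no: "\<And>n. P n \<Longrightarrow> Q (g n) \<Longrightarrow> False"
      unfolding G_def eventually_inf eventually_filtercomap by auto
    have "eventually (\<lambda>x. \<not> Q x) (filtermap g sequentially)"
      unfolding eventually_filtermap using P by eventually_elim (use no in blast)
    then have "eventually (\<lambda>_. False) (inf (nhds f) (filtermap g sequentially))"
      unfolding eventually_inf using Q by blast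
    then show False using f by (simp add: trivial_limit_def)
  qed
  moreover have "G \<le> sequentially" by (simp add: G_def)
  moreover have "((\<lambda>n. measure (\<gamma> n) E) \<longlongrightarrow> f E) G" for E
  proof -
    have g: "(g \<longlongrightarrow> f) G" by (simp add: filterlim_iff_le_filtercomap G_def)
    show ?thesis
    proof (rule topological_tendstoI)
      fix S :: "real set" assume S: "open S" "f E \<in> S"
      have "open ((\<lambda>x. x E) -` S)"
        by (rule open_vimage[OF S(1) continuous_on_product_coordinates])
      from topological_tendstoD[OF g this] S(2)
      show "\<forall>\<^sub>F n in G. measure (\<gamma> n) E \<in> S" by (simp add: g_def)
    qed
  qed
  ultimately show thesis using that by blast
qed

lemma compact_approx_from_inside:
  fixes M :: "'a::{second_countable_topology, complete_space} measure"
  assumes M: "finite_measure M" "sets M = sets borel" and A: "A \<in> sets borel" and e: "0 < e"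
  obtains K where "compact K" "K \<subseteq> A" "measure M (A - K) \<le> e"
proof -
  interpret finite_measure M by fact
  have SUP: "emeasure M A = (SUP K \<in> {K. K \<subseteq> A \<and> compact K}. emeasure M K)"
    by (rule inner_regular) (use M A in auto)
  have ne: "{K. K \<subseteq> A \<and> compact K} \<noteq> {}" by auto
  from SUP_approx_ennreal[OF e ne SUP] obtain K
    where K: "K \<subseteq> A" "compact K" "emeasure M A < emeasure M K + ennreal e" by auto
  have KM: "K \<in> sets M" "A \<in> sets M" using K(2) A M(2) by (auto intro: borel_compact)
  have "ennreal (measure M A) < ennreal (measure M K + e)"
    using K(3) e by (simp add: emeasure_eq_measure ennreal_plus)
  then have "measure M A < measure M K + e" by (simp add: ennreal_less_iff)
  then have "measure M (A - K) \<le> e" using KM K(1) by (simp add: finite_measure_Diff)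
  then show thesis using that K by blast
qed

lemma open_approx_from_outside:
  fixes M :: "'a::{second_countable_topology, complete_space} measure"
  assumes M: "finite_measure M" "sets M = sets borel" and A: "A \<in> sets borel" and e: "0 < e"
  obtains U where "open U" "A \<subseteq> U" "measure M (U - A) \<le> e"
proof -
  interpret finite_measure M by fact
  have INF: "emeasure M A = (INF U \<in> {U. A \<subseteq> U \<and> open U}. emeasure M U)"
    by (rule outer_regular) (use M A in auto)
  from INF_approx_ennreal[OF e INF] obtain U
    where U: "A \<subseteq> U" "open U" "emeasure M U < emeasure M A + ennreal e" by auto
  have UM: "U \<in> sets M" "A \<in> sets M" using U(2) A M(2) by auto
  have "ennreal (measure M U) < ennreal (measure M A + e)"
    using U(3) e by (simp add: emeasure_eq_measure ennreal_plus)
  then have "measure M U < measure M A + e" by (simp add: ennreal_less_iff)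
  then have "measure M (U - A) \<le> e" using UM U(1) by (simp add: finite_measure_Diff)
  then show thesis using that U by blast
qed

definition borel_rectangles :: "('a::topological_space \<times> 'b::topological_space) set set" where
  "borel_rectangles = {A \<times> B | A B. A \<in> sets borel \<and> B \<in> sets borel}"

lemma borel_rectangles_borel:
  "E \<in> borel_rectangles \<Longrightarrow> E \<in> sets (borel :: ('a::second_countable_topology \<times> 'b::second_countable_topology) measure)"
  unfolding borel_rectangles_def borel_prod[symmetric] by auto

lemma semiring_borel_rectangles:
  "semiring_of_sets UNIV (borel_rectangles :: ('a::topological_space \<times> 'b::topological_space) set set)"
proof
  show "{} \<in> (borel_rectangles :: ('a \<times> 'b) set set)" unfolding borel_rectangles_def by force
  fix E F :: "('a \<times> 'b) set" assume "E \<in> borel_rectangles" "F \<in> borel_rectangles"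
  then obtain A B C D where E: "E = A \<times> B" and F: "F = C \<times> D"
    and [measurable]: "A \<in> sets borel" "B \<in> sets borel" "C \<in> sets borel" "D \<in> sets borel"
    by (auto simp: borel_rectangles_def)
  have "E \<inter> F = (A \<inter> C) \<times> (B \<inter> D)" by (auto simp: E F)
  moreover have "A \<inter> C \<in> sets borel" "B \<inter> D \<in> sets borel" by measurable
  ultimately show "E \<inter> F \<in> borel_rectangles" unfolding borel_rectangles_def by blast
  have "A - C \<in> sets borel" "B - D \<in> sets borel" by measurable
  then have "(A - C) \<times> B \<in> borel_rectangles" "(A \<inter> C) \<times> (B - D) \<in> borel_rectangles"
    using \<open>A \<inter> C \<in> sets borel\<close> \<open>B \<in> sets borel\<close> unfolding borel_rectangles_def by blast+
  moreover have "E - F = \<Union>{(A - C) \<times> B, (A \<inter> C) \<times> (B - D)}" by (auto simp: E F)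
  moreover have "disjoint {(A - C) \<times> B, (A \<inter> C) \<times> (B - D)}"
  proof -
    have "((A - C) \<times> B) \<inter> ((A \<inter> C) \<times> (B - D)) = {}" by auto
    then show ?thesis by (simp add: pairwise_insert disjnt_def Int_commute)
  qed
  ultimately show "\<exists>C\<subseteq>borel_rectangles. finite C \<and> disjoint C \<and> E - F = \<Union> C"
    by (intro exI[of _ "{(A - C) \<times> B, (A \<inter> C) \<times> (B - D)}"]) simp
qed simp

text \<open>
  Countable additivity on rectangles comes from the marginals alone: a rectangle is approximated from inside by a
  product of compact sets and the members of a countable cover from outside by open rectangles. The errors are
  controlled by the marginals, and by compactness finitely many open rectangles suffice, for which
  finite additivity is enough. The extension theorem of Caratheodory then applies.
\<close>

lemma finitely_additive_coupling_extends:
  fixes f :: "('a::{second_countable_topology, complete_space} \<times> 'b::{second_countable_topology, complete_space}) set \<Rightarrow> real"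
  assumes \<mu>: "prob_space \<mu>" "sets \<mu> = sets borel" and \<nu>: "prob_space \<nu>" "sets \<nu> = sets borel"
    and nonneg: "\<And>E. 0 \<le> f E"
    and add: "\<And>E F. E \<in> sets borel \<Longrightarrow> F \<in> sets borel \<Longrightarrow> E \<inter> F = {} \<Longrightarrow> f (E \<union> F) = f E + f F"
    and fst_marginal: "\<And>A. A \<in> sets borel \<Longrightarrow> f (A \<times> UNIV) = measure \<mu> A"
    and snd_marginal: "\<And>B. B \<in> sets borel \<Longrightarrow> f (UNIV \<times> B) = measure \<nu> B"
  shows "\<exists>\<gamma>. prob_space \<gamma> \<and> sets \<gamma> = sets borel \<and>
    (\<forall>A\<in>sets borel. \<forall>B\<in>sets borel. measure \<gamma> (A \<times> B) = f (A \<times> B))"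
proof -
  interpret \<mu>: prob_space \<mu> by fact
  interpret \<nu>: prob_space \<nu> by fact
  interpret R: semiring_of_sets UNIV "borel_rectangles :: ('a \<times> 'b) set set"
    by (rule semiring_borel_rectangles)
  have rect [measurable]: "A \<times> B \<in> sets borel" if "A \<in> sets borel" "B \<in> sets borel" for A :: "'a set" and B :: "'b set"
    using that unfolding borel_prod[symmetric] by auto
  have empty: "f {} = 0" using add[of "{}" "{}"] by simp
  have mono: "f E \<le> f F" if "E \<in> sets borel" "F \<in> sets borel" "E \<subseteq> F" for E F
  proof -
    have "f (E \<union> (F - E)) = f E + f (F - E)" using that by (intro add) auto
    moreover have "E \<union> (F - E) = F" using that by auto
    ultimately show ?thesis using nonneg[of "F - E"] by simp
  qed
  have sub: "f (E \<union> F) \<le> f E + f F" if "E \<in> sets borel" "F \<in> sets borel" for E F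
  proof -
    have "f (E \<union> (F - E)) = f E + f (F - E)" using that by (intro add) auto
    moreover have "f (F - E) \<le> f F" using that by (intro mono) auto
    ultimately show ?thesis by simp
  qed
  have sub_fin: "f (\<Union>i\<in>I. E i) \<le> (\<Sum>i\<in>I. f (E i))" if "finite I" "\<And>i. E i \<in> sets borel" for I and E :: "nat \<Rightarrow> _"
    using that(1)
  proof (induction I rule: finite_induct)
    case (insert i I)
    have "f (E i \<union> (\<Union>i\<in>I. E i)) \<le> f (E i) + f (\<Union>i\<in>I. E i)"
      using that(2) insert.hyps by (intro sub) auto
    then show ?case using insert by simp
  qed (simp add: empty)
  have add_fin: "(\<Sum>i<n. f (E i)) = f (\<Union>i<n. E i)" if "\<And>i. E i \<in> sets borel" "disjoint_family E" for n :: nat and E :: "nat \<Rightarrow> _"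
  proof (induction n)
    case (Suc n)
    have "(\<Union>i<n. E i) \<inter> E n = {}"
    proof -
      have "E i \<inter> E n = {}" if "i < n" for i
        using disjoint_family_onD[OF \<open>disjoint_family E\<close>, of i n] that by simp
      then show ?thesis by blast
    qed
    then have "f ((\<Union>i<n. E i) \<union> E n) = f (\<Union>i<n. E i) + f (E n)"
      using that(1) by (intro add) auto
    then show ?case using Suc by (simp add: lessThan_Suc Un_commute)
  qed (simp add: empty)
  have "countably_additive borel_rectangles (\<lambda>E. ennreal (f E))"
  proof (rule countably_additiveI)
    fix E :: "nat \<Rightarrow> ('a \<times> 'b) set"
    assume E: "range E \<subseteq> borel_rectangles" "disjoint_family E" "(\<Union>i. E i) \<in> borel_rectangles"
    then have Eb: "E i \<in> sets borel" for i by (auto intro: borel_rectangles_borel)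
    have "\<forall>i. \<exists>A B. E i = A \<times> B \<and> A \<in> sets borel \<and> B \<in> sets borel"
      using E(1) unfolding borel_rectangles_def by blast
    then obtain A B where EAB: "\<And>i. E i = A i \<times> B i" and Ai: "\<And>i. A i \<in> sets borel" and Bi: "\<And>i. B i \<in> sets borel"
      by metis
    obtain C D where CD: "(\<Union>i. E i) = C \<times> D" and C: "C \<in> sets borel" and D: "D \<in> sets borel"
      using E(3) unfolding borel_rectangles_def by blast
    show "(\<Sum>i. ennreal (f (E i))) = ennreal (f (\<Union>i. E i))"
    proof (rule antisym)
      show "(\<Sum>i. ennreal (f (E i))) \<le> ennreal (f (\<Union>i. E i))"
        unfolding suminf_eq_SUP
      proof (rule SUP_least)
        fix n :: nat
        have "(\<Sum>i<n. ennreal (f (E i))) = ennreal (\<Sum>i<n. f (E i))" by (simp add: nonneg)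
        also have "(\<Sum>i<n. f (E i)) = f (\<Union>i<n. E i)" by (rule add_fin[OF Eb E(2)])
        also have "f (\<Union>i<n. E i) \<le> f (\<Union>i. E i)" using Eb by (intro mono) auto
        finally show "(\<Sum>i<n. ennreal (f (E i))) \<le> ennreal (f (\<Union>i. E i))" by (simp add: ennreal_leI)
      qed
      show "ennreal (f (\<Union>i. E i)) \<le> (\<Sum>i. ennreal (f (E i)))"
      proof (rule ennreal_le_epsilon)
        fix e :: real assume e: "0 < e"
        \<comment> \<open>The error \<open>e\<close> is shared by the two inner approximations, which cost \<open>d\<close> each, and the two families of
          outer ones, whose \<open>i\<close>-th members cost \<open>d / 2\<^sup>i\<^sup>+\<^sup>1\<close>.\<close>
        define d where "d = e / 4"
        have d: "0 < d" using e by (simp add: d_def)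
        obtain K where K: "compact K" "K \<subseteq> C" "measure \<mu> (C - K) \<le> d"
          by (rule compact_approx_from_inside[OF \<mu>.finite_measure_axioms \<mu>(2) C d])
        obtain L where L: "compact L" "L \<subseteq> D" "measure \<nu> (D - L) \<le> d"
          by (rule compact_approx_from_inside[OF \<nu>.finite_measure_axioms \<nu>(2) D d])
        define r where "r i = d * (1/2) ^ Suc i" for i :: nat
        have r: "0 < r i" for i using d by (simp add: r_def)
        have "\<exists>U. open U \<and> A i \<subseteq> U \<and> measure \<mu> (U - A i) \<le> r i" for i
          using open_approx_from_outside[OF \<mu>.finite_measure_axioms \<mu>(2) Ai r] by metis
        then obtain U where U: "\<And>i. open (U i)" "\<And>i. A i \<subseteq> U i" "\<And>i. measure \<mu> (U i - A i) \<le> r i"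
          by metis
        have "\<exists>U. open U \<and> B i \<subseteq> U \<and> measure \<nu> (U - B i) \<le> r i" for i
          using open_approx_from_outside[OF \<nu>.finite_measure_axioms \<nu>(2) Bi r] by metis
        then obtain V where V: "\<And>i. open (V i)" "\<And>i. B i \<subseteq> V i" "\<And>i. measure \<nu> (V i - B i) \<le> r i"
          by metis
        note [measurable] = C D borel_compact[OF K(1)] borel_compact[OF L(1)] borel_open[OF U(1)] borel_open[OF V(1)] Ai Bi
        have "K \<times> L \<subseteq> C \<times> D" using K L by blast
        also have "\<dots> \<subseteq> (\<Union>i. U i \<times> V i)"
          unfolding CD[symmetric] EAB using U(2) V(2) by blast
        finally have cover: "K \<times> L \<subseteq> (\<Union>i. U i \<times> V i)" .
        obtain I where I: "finite I" "K \<times> L \<subseteq> (\<Union>i\<in>I. U i \<times> V i)"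
        proof (rule compactE_image[OF compact_Times[OF K(1) L(1)] _ cover])
          show "open (U i \<times> V i)" for i by (rule open_Times[OF U(1) V(1)])
        qed blast
        have "f (C \<times> D) \<le> f (K \<times> L \<union> ((C - K) \<times> UNIV \<union> UNIV \<times> (D - L)))"
          by (rule mono) auto
        also have "\<dots> \<le> f (K \<times> L) + f ((C - K) \<times> UNIV \<union> UNIV \<times> (D - L))"
          by (rule sub) auto
        also have "f ((C - K) \<times> UNIV \<union> UNIV \<times> (D - L)) \<le> f ((C - K) \<times> UNIV) + f (UNIV \<times> (D - L))"
          by (rule sub) auto
        also have "f ((C - K) \<times> UNIV) + f (UNIV \<times> (D - L)) \<le> 2 * d"
          using K(3) L(3) by (simp add: fst_marginal snd_marginal)
        finally have 1: "f (C \<times> D) \<le> f (K \<times> L) + 2 * d" by simp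
        have "f (K \<times> L) \<le> f (\<Union>i\<in>I. U i \<times> V i)"
          using I by (intro mono) auto
        also have "\<dots> \<le> (\<Sum>i\<in>I. f (U i \<times> V i))"
          by (rule sub_fin[OF I(1)]) simp
        also have "\<dots> \<le> (\<Sum>i\<in>I. f (E i) + 2 * r i)"
        proof (rule sum_mono)
          fix i
          have "f (U i \<times> V i) \<le> f (E i \<union> ((U i - A i) \<times> UNIV \<union> UNIV \<times> (V i - B i)))"
            unfolding EAB by (rule mono) auto
          also have "\<dots> \<le> f (E i) + f ((U i - A i) \<times> UNIV \<union> UNIV \<times> (V i - B i))"
            by (rule sub) (auto simp: Eb)
          also have "f ((U i - A i) \<times> UNIV \<union> UNIV \<times> (V i - B i)) \<le> f ((U i - A i) \<times> UNIV) + f (UNIV \<times> (V i - B i))"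
            by (rule sub) auto
          also have "f ((U i - A i) \<times> UNIV) + f (UNIV \<times> (V i - B i)) \<le> 2 * r i"
            using U(3)[of i] V(3)[of i] by (simp add: fst_marginal snd_marginal)
          finally show "f (U i \<times> V i) \<le> f (E i) + 2 * r i" by simp
        qed
        also have "\<dots> = (\<Sum>i\<in>I. f (E i)) + 2 * (\<Sum>i\<in>I. r i)"
          by (simp add: sum.distrib sum_distrib_left)
        also have "(\<Sum>i\<in>I. r i) \<le> d"
        proof -
          have rs: "r sums d" unfolding r_def using sums_mult[OF power_half_series, of d] by simp
          have "(\<Sum>i\<in>I. r i) \<le> suminf r"
            using rs r I(1) by (intro sum_le_suminf) (auto simp: sums_iff less_imp_le)
          then show ?thesis using rs by (simp add: sums_iff)
        qed
        finally have 2: "f (K \<times> L) \<le> (\<Sum>i\<in>I. f (E i)) + 2 * d" by simp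
        have "f (\<Union>i. E i) \<le> (\<Sum>i\<in>I. f (E i)) + e" using 1 2 by (simp add: CD d_def)
        then have "ennreal (f (\<Union>i. E i)) \<le> ennreal ((\<Sum>i\<in>I. f (E i)) + e)" by (rule ennreal_leI)
        also have "\<dots> = (\<Sum>i\<in>I. ennreal (f (E i))) + ennreal e"
          using e nonneg by (simp add: sum_nonneg ennreal_plus)
        also have "(\<Sum>i\<in>I. ennreal (f (E i))) \<le> (\<Sum>i. ennreal (f (E i)))"
          by (rule sum_le_suminf) (use I(1) in auto)
        finally show "ennreal (f (\<Union>i. E i)) \<le> (\<Sum>i. ennreal (f (E i))) + ennreal e"
          by (simp add: add_right_mono)
      qed
    qed
  qed
  moreover have "positive borel_rectangles (\<lambda>E. ennreal (f E))"
    by (simp add: positive_def empty)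
  ultimately obtain m where m: "\<And>E. E \<in> borel_rectangles \<Longrightarrow> m E = ennreal (f E)"
    and ms: "measure_space UNIV (sigma_sets UNIV borel_rectangles) m"
    using R.caratheodory[of "\<lambda>E. ennreal (f E)"] by blast
  have ss: "sigma_sets UNIV borel_rectangles = sets (borel :: ('a \<times> 'b) measure)"
    unfolding borel_prod[symmetric] sets_pair_measure borel_rectangles_def by simp
  define \<gamma> where "\<gamma> = measure_of UNIV (sets borel) m"
  have s: "sets \<gamma> = sets borel" "space \<gamma> = UNIV"
    by (simp_all add: \<gamma>_def sets.sigma_sets_eq[of borel, simplified])
  have em: "emeasure \<gamma> (A \<times> B) = ennreal (f (A \<times> B))" if "A \<in> sets borel" "B \<in> sets borel" for A B
  proof -
    have "emeasure \<gamma> (A \<times> B) = m (A \<times> B)"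
      unfolding \<gamma>_def using ms that unfolding ss measure_space_def
      by (intro emeasure_measure_of_sigma) auto
    also have "\<dots> = ennreal (f (A \<times> B))" using that by (intro m) (auto simp: borel_rectangles_def)
    finally show ?thesis .
  qed
  show ?thesis
  proof (intro exI conjI ballI)
    have "f (UNIV \<times> UNIV) = measure \<mu> UNIV" by (rule fst_marginal) simp
    also have "\<dots> = 1" using \<mu>.prob_space sets_eq_imp_space_eq[OF \<mu>(2)] by simp
    finally have "f (UNIV \<times> UNIV) = 1" .
    moreover have "emeasure \<gamma> (UNIV \<times> UNIV) = ennreal (f (UNIV \<times> UNIV))" by (rule em) simp_all
    ultimately show "prob_space \<gamma>" using s(2) by (intro prob_spaceI) simp
    show "sets \<gamma> = sets borel" by (rule s(1))
    show "measure \<gamma> (A \<times> B) = f (A \<times> B)" if "A \<in> sets borel" "B \<in> sets borel" for A B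
      using em[OF that] nonneg by (simp add: measure_def)
  qed
qed

lemma simple_approx_norm2:
  fixes f :: "'a \<Rightarrow> 'b::euclidean_space"
  assumes f: "square_integrable M f" and e: "0 < e"
  obtains s where "simple_function M s" "square_integrable M s" "norm2 M (\<lambda>x. f x - s x) < e"
proof -
  have [measurable]: "f \<in> borel_measurable M" by (rule square_integrable_measurable[OF f])
  have f2: "integrable M (\<lambda>x. (norm (f x))\<^sup>2)" using f by (simp add: square_integrable_def)
  obtain F where F: "\<And>i. simple_function M (F i)" "\<And>x. x \<in> space M \<Longrightarrow> (\<lambda>i. F i x) \<longlonglongrightarrow> f x"
    and bound: "\<And>i x. x \<in> space M \<Longrightarrow> norm (F i x) \<le> 2 * norm (f x)"
    using borel_measurable_implies_sequence_metric[of f M 0] by simp metis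
  have [measurable]: "F i \<in> borel_measurable M" for i by (rule borel_measurable_simple_function[OF F(1)])
  have si: "square_integrable M (F i)" for i
    unfolding square_integrable_def
  proof
    show "integrable M (\<lambda>x. (norm (F i x))\<^sup>2)"
    proof (rule Bochner_Integration.integrable_bound)
      show "integrable M (\<lambda>x. 4 * (norm (f x))\<^sup>2)" using f2 by simp
      show "AE x in M. norm ((norm (F i x))\<^sup>2) \<le> norm (4 * (norm (f x))\<^sup>2)"
        using power_mono[OF bound norm_ge_zero, of _ i 2] by (intro AE_I2) (simp add: power_mult_distrib)
    qed measurable
  qed measurable
  have "(\<lambda>i. \<integral>x. (norm (f x - F i x))\<^sup>2 \<partial>M) \<longlonglongrightarrow> (\<integral>x. 0 \<partial>M)"
  proof (rule integral_dominated_convergence)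
    show "integrable M (\<lambda>x. 9 * (norm (f x))\<^sup>2)" using f2 by simp
    show "AE x in M. (\<lambda>i. (norm (f x - F i x))\<^sup>2) \<longlonglongrightarrow> 0"
    proof (rule AE_I2)
      fix x assume "x \<in> space M"
      then have "(\<lambda>i. (norm (f x - F i x))\<^sup>2) \<longlonglongrightarrow> (norm (f x - f x))\<^sup>2"
        by (intro tendsto_intros F(2))
      then show "(\<lambda>i. (norm (f x - F i x))\<^sup>2) \<longlonglongrightarrow> 0" by simp
    qed
    show "AE x in M. norm ((norm (f x - F i x))\<^sup>2) \<le> 9 * (norm (f x))\<^sup>2" for i
    proof (rule AE_I2)
      fix x assume "x \<in> space M"
      then have "norm (f x - F i x) \<le> 3 * norm (f x)"
        using bound[of x i] norm_triangle_ineq4[of "f x" "F i x"] by simp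
      then have "(norm (f x - F i x))\<^sup>2 \<le> (3 * norm (f x))\<^sup>2" by (rule power_mono) simp
      then show "norm ((norm (f x - F i x))\<^sup>2) \<le> 9 * (norm (f x))\<^sup>2"
        by (simp add: power_mult_distrib)
    qed
  qed measurable
  then have "(\<lambda>i. norm2 M (\<lambda>x. f x - F i x)) \<longlonglongrightarrow> sqrt 0"
    unfolding norm2_def by (intro tendsto_real_sqrt) simp
  then have "\<forall>\<^sub>F i in sequentially. norm2 M (\<lambda>x. f x - F i x) < e"
    using order_tendstoD(2)[of _ "sqrt 0" sequentially e] e by simp
  then obtain i where "norm2 M (\<lambda>x. f x - F i x) < e" by (auto simp: eventually_sequentially)
  then show thesis using that F(1) si by blast
qed

lemma inner_simple_functions_as_rectangles:
  fixes s t :: "'a::euclidean_space \<Rightarrow> 'a"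
  assumes s: "simple_function borel s" and t: "simple_function borel t"
    and \<gamma>: "prob_space \<gamma>" "sets \<gamma> = sets borel"
  shows "(\<integral>z. s (fst z) \<bullet> t (snd z) \<partial>\<gamma>)
    = (\<Sum>a\<in>range s. \<Sum>b\<in>range t. (a \<bullet> b) * measure \<gamma> ((s -` {a}) \<times> (t -` {b})))"
proof -
  interpret prob_space \<gamma> by fact
  have fin: "finite (range s)" "finite (range t)"
    using simple_functionD(1)[OF s] simple_functionD(1)[OF t] by simp_all
  have "s -` {a} \<in> sets borel" "t -` {a} \<in> sets borel" for a
    using simple_functionD(2)[OF s, of "{a}"] simple_functionD(2)[OF t, of "{a}"] by simp_all
  then have rect: "(s -` {a}) \<times> (t -` {b}) \<in> sets \<gamma>" for a b
    unfolding \<gamma>(2) borel_prod[symmetric] by auto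
  have "s (fst z) \<bullet> t (snd z)
      = (\<Sum>a\<in>range s. \<Sum>b\<in>range t. (a \<bullet> b) * indicator ((s -` {a}) \<times> (t -` {b})) z)" for z
  proof -
    have "(\<Sum>a\<in>range s. \<Sum>b\<in>range t. (a \<bullet> b) * indicator ((s -` {a}) \<times> (t -` {b})) z)
        = (\<Sum>a\<in>range s. \<Sum>b\<in>range t. if a = s (fst z) \<and> b = t (snd z) then a \<bullet> b else 0)"
      by (intro sum.cong refl) (auto simp: indicator_def mem_Times_iff)
    also have "\<dots> = (\<Sum>a\<in>range s. if a = s (fst z) then a \<bullet> t (snd z) else 0)"
      by (intro sum.cong refl) (auto simp: fin(2) sum.delta)
    also have "\<dots> = s (fst z) \<bullet> t (snd z)" by (simp add: fin(1) sum.delta)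
    finally show ?thesis by simp
  qed
  then have "(\<integral>z. s (fst z) \<bullet> t (snd z) \<partial>\<gamma>)
      = (\<integral>z. (\<Sum>a\<in>range s. \<Sum>b\<in>range t. (a \<bullet> b) * indicator ((s -` {a}) \<times> (t -` {b})) z) \<partial>\<gamma>)"
    by simp
  also have "\<dots> = (\<Sum>a\<in>range s. \<Sum>b\<in>range t. \<integral>z. (a \<bullet> b) * indicator ((s -` {a}) \<times> (t -` {b})) z \<partial>\<gamma>)"
  proof -
    have i: "integrable \<gamma> (\<lambda>z. (a \<bullet> b) * indicat_real ((s -` {a}) \<times> (t -` {b})) z)" for a b
      using rect[of a b] by (intro integrable_mult_right integrable_real_indicator) (auto simp: less_top[symmetric])
    show ?thesis
      by (simp only: Bochner_Integration.integral_sum Bochner_Integration.integrable_sum i)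
  qed
  also have "\<dots> = (\<Sum>a\<in>range s. \<Sum>b\<in>range t. (a \<bullet> b) * measure \<gamma> ((s -` {a}) \<times> (t -` {b})))"
    using rect by simp
  finally show ?thesis .
qed

text \<open>
  The error bound depends only on the marginals. This uniformity over all plans is what lets the integral of
  \<open>x \<bullet> y\<close> pass to the limit.
\<close>

lemma inner_plan_approx:
  assumes \<gamma>: "\<gamma> \<in> plans \<mu> \<nu>"
    and s: "square_integrable \<mu> s" "norm2 \<mu> (\<lambda>x. x - s x) \<le> e"
    and t: "square_integrable \<nu> t" "norm2 \<nu> (\<lambda>x. x - t x) \<le> e"
  shows "\<bar>(\<integral>z. fst z \<bullet> snd z \<partial>\<gamma>) - (\<integral>z. s (fst z) \<bullet> t (snd z) \<partial>\<gamma>)\<bar>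
    \<le> e * (norm2 \<nu> (\<lambda>x. x) + norm2 \<mu> (\<lambda>x. x) + e)"
proof -
  let ?s = "\<lambda>z. s (fst z)" and ?t = "\<lambda>z. t (snd z)"
  note P = P2D(3)[OF plans_P2(1)[OF \<gamma>]] P2D(3)[OF plans_P2(2)[OF \<gamma>]]
  note x = plans_fst[OF \<gamma> P(1)] and y = plans_snd[OF \<gamma> P(2)]
  note s' = plans_fst[OF \<gamma> s(1)] and t' = plans_snd[OF \<gamma> t(1)]
  note ds = plans_fst[OF \<gamma> square_integrable_diff[OF P(1) s(1)]]
  note dt = plans_snd[OF \<gamma> square_integrable_diff[OF P(2) t(1)]]
  have e: "0 \<le> e" using s(2) norm2_nonneg order_trans by blast
  have "norm2 \<gamma> ?s \<le> norm2 \<gamma> fst + norm2 \<gamma> (\<lambda>z. fst z - s (fst z))"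
  proof -
    have "norm2 \<gamma> ?s = norm2 \<gamma> (\<lambda>z. fst z + (- 1) *\<^sub>R (fst z - s (fst z)))" by simp
    also have "\<dots> \<le> norm2 \<gamma> fst + norm2 \<gamma> (\<lambda>z. (- 1) *\<^sub>R (fst z - s (fst z)))"
      by (rule norm2_triangle[OF x(1) square_integrable_scaleR[OF ds(1)]])
    also have "norm2 \<gamma> (\<lambda>z. (- 1) *\<^sub>R (fst z - s (fst z))) = norm2 \<gamma> (\<lambda>z. fst z - s (fst z))"
      by (subst norm2_scaleR) simp
    finally show ?thesis .
  qed
  then have ns: "norm2 \<gamma> ?s \<le> norm2 \<mu> (\<lambda>x. x) + e" using s(2) by (simp add: x(2) ds(2))
  have split: "fst z \<bullet> snd z - ?s z \<bullet> ?t z = (fst z - s (fst z)) \<bullet> snd z + ?s z \<bullet> (snd z - t (snd z))" for z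
    by (simp add: algebra_simps)
  have "(\<integral>z. fst z \<bullet> snd z \<partial>\<gamma>) - (\<integral>z. ?s z \<bullet> ?t z \<partial>\<gamma>) = (\<integral>z. fst z \<bullet> snd z - ?s z \<bullet> ?t z \<partial>\<gamma>)"
    by (rule Bochner_Integration.integral_diff[symmetric])
      (rule square_integrable_inner x(1) y(1) s'(1) t'(1))+
  also have "\<dots> = (\<integral>z. (fst z - s (fst z)) \<bullet> snd z \<partial>\<gamma>) + (\<integral>z. ?s z \<bullet> (snd z - t (snd z)) \<partial>\<gamma>)"
    unfolding split by (rule Bochner_Integration.integral_add)
      (rule square_integrable_inner ds(1) y(1) s'(1) dt(1))+
  finally have "\<bar>(\<integral>z. fst z \<bullet> snd z \<partial>\<gamma>) - (\<integral>z. ?s z \<bullet> ?t z \<partial>\<gamma>)\<bar>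
      \<le> norm2 \<gamma> (\<lambda>z. fst z - s (fst z)) * norm2 \<gamma> snd + norm2 \<gamma> ?s * norm2 \<gamma> (\<lambda>z. snd z - t (snd z))"
    using Cauchy_Schwarz_integral[OF ds(1) y(1)] Cauchy_Schwarz_integral[OF s'(1) dt(1)] by linarith
  also have "\<dots> \<le> e * norm2 \<nu> (\<lambda>x. x) + (norm2 \<mu> (\<lambda>x. x) + e) * e"
    using s(2) t(2) ns e by (intro add_mono mult_mono) (simp_all add: ds(2) dt(2) y(2) add_nonneg_nonneg)
  finally show ?thesis by (simp add: algebra_simps)
qed

text \<open>
  Convergence on rectangles is convergence of the integral of \<open>s(x) \<bullet> t(y)\<close> for simple functions \<open>s\<close> and \<open>t\<close>, and
  the identity is a limit of simple functions in \<open>L\<^sup>2\<close> of each marginal.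
\<close>

lemma inner_plan_tendsto:
  fixes \<mu> \<nu> :: "'a::euclidean_space measure"
  assumes \<gamma>: "\<And>n. \<gamma> n \<in> plans \<mu> \<nu>" and \<eta>: "\<eta> \<in> plans \<mu> \<nu>"
    and conv: "\<And>A B. A \<in> sets borel \<Longrightarrow> B \<in> sets borel \<Longrightarrow>
      ((\<lambda>n. measure (\<gamma> n) (A \<times> B)) \<longlongrightarrow> measure \<eta> (A \<times> B)) G"
  shows "((\<lambda>n. \<integral>z. fst z \<bullet> snd z \<partial>\<gamma> n) \<longlongrightarrow> (\<integral>z. fst z \<bullet> snd z \<partial>\<eta>)) G"
proof (rule tendstoI)
  fix \<epsilon> :: real assume \<epsilon>: "0 < \<epsilon>"
  note P = plans_P2[OF \<eta>]
  note \<mu> = P2D[OF P(1)] and \<nu> = P2D[OF P(2)]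
  define C where "C = norm2 \<nu> (\<lambda>x. x) + norm2 \<mu> (\<lambda>x. x) + 1"
  have C: "0 < C" unfolding C_def by (simp add: add_nonneg_pos)
  define e where "e = min 1 (\<epsilon> / (3 * C))"
  have e: "0 < e" "e \<le> 1" using C \<epsilon> by (simp_all add: e_def)
  have eC: "e * C \<le> \<epsilon> / 3"
    using C mult_right_mono[of e "\<epsilon> / (3 * C)" C] by (simp add: e_def)
  have sp: "space \<mu> = UNIV" "space \<nu> = UNIV" using sets_eq_imp_space_eq[OF \<mu>(1)] sets_eq_imp_space_eq[OF \<nu>(1)] by simp_all
  obtain s where s0: "simple_function \<mu> s" and s: "square_integrable \<mu> s" "norm2 \<mu> (\<lambda>x. x - s x) < e"
    by (rule simple_approx_norm2[OF \<mu>(3) e(1)])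
  obtain t where t0: "simple_function \<nu> t" and t: "square_integrable \<nu> t" "norm2 \<nu> (\<lambda>x. x - t x) < e"
    by (rule simple_approx_norm2[OF \<nu>(3) e(1)])
  have sb: "simple_function borel s" and tb: "simple_function borel t"
    using s0 t0 \<mu>(1) \<nu>(1) sp by (simp_all add: simple_function_def)
  have close: "\<bar>(\<integral>z. fst z \<bullet> snd z \<partial>\<zeta>) - (\<integral>z. s (fst z) \<bullet> t (snd z) \<partial>\<zeta>)\<bar> \<le> \<epsilon> / 3"
    if "\<zeta> \<in> plans \<mu> \<nu>" for \<zeta>
  proof -
    have "\<bar>(\<integral>z. fst z \<bullet> snd z \<partial>\<zeta>) - (\<integral>z. s (fst z) \<bullet> t (snd z) \<partial>\<zeta>)\<bar>
        \<le> e * (norm2 \<nu> (\<lambda>x. x) + norm2 \<mu> (\<lambda>x. x) + e)"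
      by (rule inner_plan_approx[OF that s(1) _ t(1)]) (use s(2) t(2) in simp_all)
    also have "\<dots> \<le> e * C" using e by (intro mult_left_mono) (simp_all add: C_def)
    finally show ?thesis using eC by simp
  qed
  have pre: "s -` {a} \<in> sets borel" "t -` {a} \<in> sets borel" for a
    using simple_functionD(2)[OF sb, of "{a}"] simple_functionD(2)[OF tb, of "{a}"] by simp_all
  have "((\<lambda>n. \<Sum>a\<in>range s. \<Sum>b\<in>range t. (a \<bullet> b) * measure (\<gamma> n) ((s -` {a}) \<times> (t -` {b})))
    \<longlongrightarrow> (\<Sum>a\<in>range s. \<Sum>b\<in>range t. (a \<bullet> b) * measure \<eta> ((s -` {a}) \<times> (t -` {b})))) G"
    by (intro tendsto_sum tendsto_mult tendsto_const conv pre)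
  then have "((\<lambda>n. \<integral>z. s (fst z) \<bullet> t (snd z) \<partial>\<gamma> n) \<longlongrightarrow> (\<integral>z. s (fst z) \<bullet> t (snd z) \<partial>\<eta>)) G"
    using inner_simple_functions_as_rectangles[OF sb tb plansD(1,2)[OF \<gamma>]]
      inner_simple_functions_as_rectangles[OF sb tb plansD(1,2)[OF \<eta>]] by simp
  then have "\<forall>\<^sub>F n in G. dist (\<integral>z. s (fst z) \<bullet> t (snd z) \<partial>\<gamma> n) (\<integral>z. s (fst z) \<bullet> t (snd z) \<partial>\<eta>) < \<epsilon> / 3"
    using \<epsilon> by (intro tendstoD) simp_all
  then show "\<forall>\<^sub>F n in G. dist (\<integral>z. fst z \<bullet> snd z \<partial>\<gamma> n) (\<integral>z. fst z \<bullet> snd z \<partial>\<eta>) < \<epsilon>"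
  proof eventually_elim
    case (elim n)
    then show ?case using close[OF \<gamma>[of n]] close[OF \<eta>] unfolding dist_real_def by linarith
  qed
qed

lemma cost_of_plan:
  assumes \<gamma>: "\<gamma> \<in> plans \<mu> \<nu>"
  shows "(norm2 \<gamma> (\<lambda>z. snd z - fst z))\<^sup>2
    = (norm2 \<mu> (\<lambda>x. x))\<^sup>2 - 2 * (\<integral>z. fst z \<bullet> snd z \<partial>\<gamma>) + (norm2 \<nu> (\<lambda>x. x))\<^sup>2"
proof -
  note x = plans_fst[OF \<gamma> P2D(3)[OF plans_P2(1)[OF \<gamma>]]] and y = plans_snd[OF \<gamma> P2D(3)[OF plans_P2(2)[OF \<gamma>]]]
  show ?thesis
    using norm2_lincomb_squared[OF x(1) y(1), of "-1" 1] by (simp add: x(2) y(2))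
qed

text \<open>
  The limit of a minimizing sequence along the filter is finitely additive with the prescribed marginals, so on
  rectangles it agrees with a plan, and the cost of that plan is the limit of the costs.
\<close>

lemma optimal_plan_exists:
  fixes \<mu> \<nu> :: "'a::euclidean_space measure"
  assumes P: "\<mu> \<in> P2" "\<nu> \<in> P2"
  shows "optimal_plans \<mu> \<nu> \<noteq> {}"
proof -
  note \<mu> = P2D[OF P(1)] and \<nu> = P2D[OF P(2)]
  have "\<exists>\<gamma>. \<gamma> \<in> plans \<mu> \<nu> \<and> norm2 \<gamma> (\<lambda>z. snd z - fst z) < W2 \<mu> \<nu> + 1 / Suc n" for n
    using W2_approx[OF P, of "1 / Suc n"] by (metis of_nat_0_less_iff zero_less_Suc zero_less_divide_1_iff)
  then obtain \<gamma> where \<gamma>: "\<And>n. \<gamma> n \<in> plans \<mu> \<nu>"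
    and min: "\<And>n. norm2 (\<gamma> n) (\<lambda>z. snd z - fst z) < W2 \<mu> \<nu> + 1 / Suc n" by metis
  note p = plansD[OF \<gamma>]
  obtain G f where G: "G \<le> sequentially" "G \<noteq> bot" and f: "\<And>E. ((\<lambda>n. measure (\<gamma> n) E) \<longlongrightarrow> f E) G"
    by (rule setwise_convergence_along_filter[of \<gamma>]) (use p(1) in blast)+
  have sp: "space (\<gamma> n) = UNIV" for n using sets_eq_imp_space_eq[OF p(2)] by simp
  have f1: "f (A \<times> UNIV) = measure \<mu> A" if "A \<in> sets borel" for A
  proof -
    have "measure (\<gamma> n) (A \<times> UNIV) = measure \<mu> A" for n
    proof -
      have "measure \<mu> A = measure (distr (\<gamma> n) borel fst) A" by (simp add: p(3))
      also have "\<dots> = measure (\<gamma> n) (fst -` A \<inter> space (\<gamma> n))" by (rule measure_distr[OF p(5) that])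
      also have "fst -` A \<inter> space (\<gamma> n) = A \<times> UNIV" by (auto simp: sp)
      finally show ?thesis by simp
    qed
    then show ?thesis using tendsto_unique[OF G(2) f[of "A \<times> UNIV"]] by simp
  qed
  have f2: "f (UNIV \<times> A) = measure \<nu> A" if "A \<in> sets borel" for A
  proof -
    have "measure (\<gamma> n) (UNIV \<times> A) = measure \<nu> A" for n
    proof -
      have "measure \<nu> A = measure (distr (\<gamma> n) borel snd) A" by (simp add: p(4))
      also have "\<dots> = measure (\<gamma> n) (snd -` A \<inter> space (\<gamma> n))" by (rule measure_distr[OF p(6) that])
      also have "snd -` A \<inter> space (\<gamma> n) = UNIV \<times> A" by (auto simp: sp)
      finally show ?thesis by simp
    qed
    then show ?thesis using tendsto_unique[OF G(2) f[of "UNIV \<times> A"]] by simp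
  qed
  have fpos: "0 \<le> f E" for E
    by (rule tendsto_lowerbound[OF f _ G(2)]) simp
  have fadd: "f (E \<union> F) = f E + f F" if "E \<in> sets borel" "F \<in> sets borel" "E \<inter> F = {}" for E F
  proof -
    have "measure (\<gamma> n) (E \<union> F) = measure (\<gamma> n) E + measure (\<gamma> n) F" for n
    proof -
      interpret prob_space "\<gamma> n" by (rule p(1))
      show ?thesis by (rule finite_measure_Union) (use that p(2) in auto)
    qed
    then have "((\<lambda>n. measure (\<gamma> n) E + measure (\<gamma> n) F) \<longlongrightarrow> f (E \<union> F)) G"
      using f[of "E \<union> F"] by simp
    then show ?thesis using tendsto_unique[OF G(2) _ tendsto_add[OF f f]] by blast
  qed
  obtain \<eta> where \<eta>: "prob_space \<eta>" "sets \<eta> = sets borel"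
    and rect: "\<And>A B. A \<in> sets borel \<Longrightarrow> B \<in> sets borel \<Longrightarrow> measure \<eta> (A \<times> B) = f (A \<times> B)"
    using finitely_additive_coupling_extends[OF \<mu>(2,1) \<nu>(2,1) fpos fadd f1 f2] by blast
  interpret \<eta>: prob_space \<eta> by fact
  interpret \<mu>: prob_space \<mu> by (rule \<mu>(2))
  interpret \<nu>: prob_space \<nu> by (rule \<nu>(2))
  have m [measurable]: "fst \<in> borel_measurable \<eta>" "snd \<in> borel_measurable \<eta>"
    by (simp_all add: measurable_cong_sets[OF \<eta>(2) refl])
  have sp\<eta>: "space \<eta> = UNIV" using sets_eq_imp_space_eq[OF \<eta>(2)] by simp
  have d1: "distr \<eta> borel fst = \<mu>"
  proof (rule measure_eqI)
    fix A assume "A \<in> sets (distr \<eta> borel fst)"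
    then have A: "A \<in> sets borel" by simp
    have "fst -` A \<inter> space \<eta> = A \<times> UNIV" by (auto simp: sp\<eta>)
    then show "emeasure (distr \<eta> borel fst) A = emeasure \<mu> A"
      using A by (simp add: emeasure_distr \<eta>.emeasure_eq_measure \<mu>.emeasure_eq_measure rect f1)
  qed (simp add: \<mu>(1))
  have d2: "distr \<eta> borel snd = \<nu>"
  proof (rule measure_eqI)
    fix A assume "A \<in> sets (distr \<eta> borel snd)"
    then have A: "A \<in> sets borel" by simp
    have "snd -` A \<inter> space \<eta> = UNIV \<times> A" by (auto simp: sp\<eta>)
    then show "emeasure (distr \<eta> borel snd) A = emeasure \<nu> A"
      using A by (simp add: emeasure_distr \<eta>.emeasure_eq_measure \<nu>.emeasure_eq_measure rect f2)
  qed (simp add: \<nu>(1))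
  have \<eta>p: "\<eta> \<in> plans \<mu> \<nu>"
  proof -
    have "distr \<eta> borel (\<lambda>z. (fst z, snd z)) = \<eta>"
      using distr_id2[OF \<eta>(2)[symmetric]] by simp
    then show ?thesis using plansI_coupling[OF \<eta>(1) m d1 P(1) d2 P(2)] by simp
  qed
  have "((\<lambda>n. \<integral>z. fst z \<bullet> snd z \<partial>\<gamma> n) \<longlongrightarrow> (\<integral>z. fst z \<bullet> snd z \<partial>\<eta>)) G"
    by (rule inner_plan_tendsto[OF \<gamma> \<eta>p]) (use f in \<open>simp add: rect\<close>)
  then have "((\<lambda>n. (norm2 (\<gamma> n) (\<lambda>z. snd z - fst z))\<^sup>2) \<longlongrightarrow> (norm2 \<eta> (\<lambda>z. snd z - fst z))\<^sup>2) G"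
    unfolding cost_of_plan[OF \<gamma>] cost_of_plan[OF \<eta>p] by (intro tendsto_intros)
  moreover have "((\<lambda>n. (W2 \<mu> \<nu> + 1 / Suc n)\<^sup>2) \<longlongrightarrow> (W2 \<mu> \<nu> + 0)\<^sup>2) G"
    by (rule tendsto_mono[OF G(1)]) (intro tendsto_intros LIMSEQ_Suc[OF lim_1_over_n])
  moreover have "\<forall>\<^sub>F n in G. (norm2 (\<gamma> n) (\<lambda>z. snd z - fst z))\<^sup>2 \<le> (W2 \<mu> \<nu> + 1 / Suc n)\<^sup>2"
    using min by (intro always_eventually allI power_mono) (auto intro: less_imp_le)
  ultimately have "(norm2 \<eta> (\<lambda>z. snd z - fst z))\<^sup>2 \<le> (W2 \<mu> \<nu> + 0)\<^sup>2"
    using tendsto_le[OF G(2)] by blast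
  then have "norm2 \<eta> (\<lambda>z. snd z - fst z) \<le> W2 \<mu> \<nu>"
    using power2_le_imp_le W2_nonneg[OF P] by force
  then have "\<eta> \<in> optimal_plans \<mu> \<nu>"
    using W2_le[OF \<eta>p] \<eta>p by (simp add: optimal_plans_iff)
  then show ?thesis by blast
qed

section \<open>The differential contains the gradient\<close>

lemma differential_square_integrable:
  "\<xi> \<in> wasserstein_differential F \<mu> \<Longrightarrow> square_integrable \<mu> \<xi>"
  by (simp add: wasserstein_differential_def L2_iff)

lemma wasserstein_differential_midpoint:
  assumes f: "f \<in> wasserstein_differential F \<mu>" and g: "g \<in> wasserstein_differential F \<mu>"
  shows "(\<lambda>x. (1/2) *\<^sub>R f x + (1/2) *\<^sub>R g x) \<in> wasserstein_differential F \<mu>"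
proof -
  have fs: "square_integrable \<mu> f" and gs: "square_integrable \<mu> g"
    using f g by (simp_all add: differential_square_integrable)
  let ?h = "\<lambda>x. (1/2) *\<^sub>R f x + (1/2) *\<^sub>R g x"
  have "\<exists>\<delta>>0. \<forall>\<nu>\<in>P2. W2 \<mu> \<nu> < \<delta> \<longrightarrow> (\<forall>\<gamma>\<in>optimal_plans \<mu> \<nu>.
     \<bar>F \<nu> - F \<mu> - (\<integral>x. ?h (fst x) \<bullet> (snd x - fst x) \<partial>\<gamma>)\<bar> \<le> \<epsilon> * W2 \<mu> \<nu>)" if \<epsilon>: "\<epsilon> > 0" for \<epsilon>
  proof -
    obtain d1 where d1: "d1 > 0" "\<And>\<nu> \<gamma>. \<nu> \<in> P2 \<Longrightarrow> W2 \<mu> \<nu> < d1 \<Longrightarrow> \<gamma> \<in> optimal_plans \<mu> \<nu> \<Longrightarrow>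
      \<bar>F \<nu> - F \<mu> - (\<integral>x. f (fst x) \<bullet> (snd x - fst x) \<partial>\<gamma>)\<bar> \<le> \<epsilon> * W2 \<mu> \<nu>"
      using f \<epsilon> unfolding wasserstein_differential_def by blast
    obtain d2 where d2: "d2 > 0" "\<And>\<nu> \<gamma>. \<nu> \<in> P2 \<Longrightarrow> W2 \<mu> \<nu> < d2 \<Longrightarrow> \<gamma> \<in> optimal_plans \<mu> \<nu> \<Longrightarrow>
      \<bar>F \<nu> - F \<mu> - (\<integral>x. g (fst x) \<bullet> (snd x - fst x) \<partial>\<gamma>)\<bar> \<le> \<epsilon> * W2 \<mu> \<nu>"
      using g \<epsilon> unfolding wasserstein_differential_def by blast
    show ?thesis
    proof (intro exI[of _ "min d1 d2"] conjI ballI impI)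
      show "0 < min d1 d2" using d1(1) d2(1) by simp
      fix \<nu> \<gamma> assume \<nu>: "\<nu> \<in> P2" "W2 \<mu> \<nu> < min d1 d2" and \<gamma>: "\<gamma> \<in> optimal_plans \<mu> \<nu>"
      then have \<gamma>p: "\<gamma> \<in> plans \<mu> \<nu>" by (simp add: optimal_plans_iff)
      let ?D = "\<lambda>x. snd x - fst x"
      have i: "integrable \<gamma> (\<lambda>x. f (fst x) \<bullet> ?D x)" "integrable \<gamma> (\<lambda>x. g (fst x) \<bullet> ?D x)"
        by (intro square_integrable_inner plans_fst(1)[OF \<gamma>p] plans_displacement[OF \<gamma>p] fs gs)+
      have "(\<integral>x. ?h (fst x) \<bullet> ?D x \<partial>\<gamma>) = (\<integral>x. (1/2) * (f (fst x) \<bullet> ?D x) + (1/2) * (g (fst x) \<bullet> ?D x) \<partial>\<gamma>)"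
        by (simp only: inner_add_left inner_scaleR_left)
      also have "\<dots> = (1/2) * (\<integral>x. f (fst x) \<bullet> ?D x \<partial>\<gamma>) + (1/2) * (\<integral>x. g (fst x) \<bullet> ?D x \<partial>\<gamma>)"
        using i by (subst Bochner_Integration.integral_add) simp_all
      finally show "\<bar>F \<nu> - F \<mu> - (\<integral>x. ?h (fst x) \<bullet> ?D x \<partial>\<gamma>)\<bar> \<le> \<epsilon> * W2 \<mu> \<nu>"
        using d1(2)[OF \<nu>(1) _ \<gamma>] d2(2)[OF \<nu>(1) _ \<gamma>] \<nu>(2) by simp
    qed
  qed
  then show ?thesis
    using square_integrable_add[OF square_integrable_scaleR[OF fs] square_integrable_scaleR[OF gs]]
    by (simp add: wasserstein_differential_def L2_iff)
qed

text \<open>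
  By the Cauchy--Schwarz inequality, replacing \<open>f\<close> by \<open>g\<close> changes the first-order term by at most the distance of \<open>f\<close>
  and \<open>g\<close> times \<open>W2 \<mu> \<nu>\<close>, uniformly in \<open>\<nu>\<close>.
\<close>

lemma wasserstein_differential_closed:
  assumes f: "square_integrable \<mu> f"
    and approx: "\<And>e. e > 0 \<Longrightarrow> \<exists>g\<in>wasserstein_differential F \<mu>. norm2 \<mu> (\<lambda>x. f x - g x) \<le> e"
  shows "f \<in> wasserstein_differential F \<mu>"
proof -
  have "\<exists>\<delta>>0. \<forall>\<nu>\<in>P2. W2 \<mu> \<nu> < \<delta> \<longrightarrow> (\<forall>\<gamma>\<in>optimal_plans \<mu> \<nu>.
     \<bar>F \<nu> - F \<mu> - (\<integral>x. f (fst x) \<bullet> (snd x - fst x) \<partial>\<gamma>)\<bar> \<le> \<epsilon> * W2 \<mu> \<nu>)" if \<epsilon>: "\<epsilon> > 0" for \<epsilon>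
  proof -
    obtain g where g: "g \<in> wasserstein_differential F \<mu>" "norm2 \<mu> (\<lambda>x. f x - g x) \<le> \<epsilon>/2"
      using approx[of "\<epsilon>/2"] \<epsilon> by auto
    have gs: "square_integrable \<mu> g" using g(1) by (rule differential_square_integrable)
    obtain d where d: "d > 0" "\<And>\<nu> \<gamma>. \<nu> \<in> P2 \<Longrightarrow> W2 \<mu> \<nu> < d \<Longrightarrow> \<gamma> \<in> optimal_plans \<mu> \<nu> \<Longrightarrow>
      \<bar>F \<nu> - F \<mu> - (\<integral>x. g (fst x) \<bullet> (snd x - fst x) \<partial>\<gamma>)\<bar> \<le> \<epsilon>/2 * W2 \<mu> \<nu>"
      using g(1) half_gt_zero[OF \<epsilon>] unfolding wasserstein_differential_def by blast
    show ?thesis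
    proof (intro exI[of _ d] conjI ballI impI d(1))
      fix \<nu> \<gamma> assume \<nu>: "\<nu> \<in> P2" "W2 \<mu> \<nu> < d" and \<gamma>: "\<gamma> \<in> optimal_plans \<mu> \<nu>"
      then have \<gamma>p: "\<gamma> \<in> plans \<mu> \<nu>" and nD: "norm2 \<gamma> (\<lambda>x. snd x - fst x) = W2 \<mu> \<nu>"
        by (simp_all add: optimal_plans_iff)
      let ?D = "\<lambda>x. snd x - fst x"
      note D = plans_displacement[OF \<gamma>p]
      note fg = plans_fst[OF \<gamma>p square_integrable_diff[OF f gs]]
      have "(\<integral>x. f (fst x) \<bullet> ?D x \<partial>\<gamma>) - (\<integral>x. g (fst x) \<bullet> ?D x \<partial>\<gamma>)
          = (\<integral>x. f (fst x) \<bullet> ?D x - g (fst x) \<bullet> ?D x \<partial>\<gamma>)"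
        by (intro Bochner_Integration.integral_diff[symmetric] square_integrable_inner D
            plans_fst(1)[OF \<gamma>p] f gs)
      also have "\<dots> = (\<integral>x. (f (fst x) - g (fst x)) \<bullet> ?D x \<partial>\<gamma>)"
        by (simp only: inner_diff_left)
      finally have "\<bar>(\<integral>x. f (fst x) \<bullet> ?D x \<partial>\<gamma>) - (\<integral>x. g (fst x) \<bullet> ?D x \<partial>\<gamma>)\<bar>
          \<le> norm2 \<gamma> (\<lambda>z. f (fst z) - g (fst z)) * W2 \<mu> \<nu>"
        using Cauchy_Schwarz_integral[OF fg(1) D] by (simp only: nD)
      also have "\<dots> \<le> \<epsilon>/2 * W2 \<mu> \<nu>"
        unfolding fg(2) using g(2) W2_nonneg[OF plans_P2[OF \<gamma>p]] by (rule mult_right_mono)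
      finally show "\<bar>F \<nu> - F \<mu> - (\<integral>x. f (fst x) \<bullet> ?D x \<partial>\<gamma>)\<bar> \<le> \<epsilon> * W2 \<mu> \<nu>"
        using d(2)[OF \<nu> \<gamma>] by linarith
    qed
  qed
  then show ?thesis using f by (simp add: wasserstein_differential_def L2_iff)
qed

lemma wasserstein_gradient_in_differential:
  assumes \<mu>: "\<mu> \<in> P2" and diff: "wasserstein_differentiable_at F \<mu>"
  shows "wasserstein_gradient F \<mu> \<in> wasserstein_differential F \<mu>"
proof -
  interpret prob_space \<mu> by (rule P2D(2)[OF \<mu>])
  let ?S = "wasserstein_differential F \<mu>"
  have "\<exists>f\<in>?S. \<forall>g\<in>?S. norm2 \<mu> f \<le> norm2 \<mu> g"
  proof (rule exists_minimal_norm2)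
    show "?S \<noteq> {}" using diff by (simp add: wasserstein_differentiable_at_def)
    show "square_integrable \<mu> f" if "f \<in> ?S" for f
      using that by (rule differential_square_integrable)
  qed (rule wasserstein_differential_midpoint wasserstein_differential_closed; assumption)+
  then obtain f where f: "f \<in> ?S" "\<And>g. g \<in> ?S \<Longrightarrow> norm2 \<mu> f \<le> norm2 \<mu> g" by blast
  show ?thesis
    unfolding wasserstein_gradient_def L2_norm_eq arg_min_on_def
    by (rule arg_minI[of "\<lambda>x. x \<in> ?S" f]) (use f in \<open>auto simp: not_less\<close>)
qed

section \<open>Interpolation along a plan\<close>

definition interpolate :: "('a::euclidean_space \<times> 'a) measure \<Rightarrow> real \<Rightarrow> 'a measure" where
  "interpolate \<gamma> t = distr \<gamma> borel (\<lambda>z. (1 - t) *\<^sub>R fst z + t *\<^sub>R snd z)"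

lemma interpolate_P2:
  fixes \<gamma> :: "('a::euclidean_space \<times> 'a) measure"
  assumes \<gamma>: "\<gamma> \<in> plans \<mu> \<nu>"
  shows "interpolate \<gamma> t \<in> P2"
proof -
  note p = plansD[OF \<gamma>]
  note [measurable] = p(5,6)
  have "square_integrable \<gamma> (\<lambda>z. (1 - t) *\<^sub>R fst z + t *\<^sub>R snd z)"
    by (intro square_integrable_add square_integrable_scaleR p(7,8))
  then show ?thesis
    by (auto simp: interpolate_def P2_iff square_integrable_distr intro!: prob_space.prob_space_distr[OF p(1)])
qed

lemma interpolate_0_1:
  assumes "\<gamma> \<in> plans \<mu> \<nu>"
  shows "interpolate \<gamma> 0 = \<mu>" "interpolate \<gamma> 1 = \<nu>"
  using plansD(3,4)[OF assms] by (simp_all add: interpolate_def)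

lemma interpolate_swap:
  fixes \<gamma> :: "('a::euclidean_space \<times> 'a) measure"
  assumes "\<gamma> \<in> plans \<mu> \<nu>"
  shows "interpolate (distr \<gamma> borel prod.swap) t = interpolate \<gamma> (1 - t)"
  unfolding interpolate_def
  by (subst distr_distr) (simp_all add: comp_def swap_measurable[OF assms] add.commute)

definition interpolation_plan ::
    "('a::euclidean_space \<times> 'a) measure \<Rightarrow> real \<Rightarrow> real \<Rightarrow> ('a \<times> 'a) measure" where
  "interpolation_plan \<gamma> s t = distr \<gamma> borel
     (\<lambda>z. ((1 - s) *\<^sub>R fst z + s *\<^sub>R snd z, (1 - t) *\<^sub>R fst z + t *\<^sub>R snd z))"

lemma interpolation_displacement:
  fixes x y :: "'a::real_vector"
  shows "((1 - t) *\<^sub>R x + t *\<^sub>R y) - ((1 - s) *\<^sub>R x + s *\<^sub>R y) = (t - s) *\<^sub>R (y - x)"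
  by (simp add: algebra_simps)

lemma interpolation_plan_in_plans:
  fixes \<gamma> :: "('a::euclidean_space \<times> 'a) measure"
  assumes \<gamma>: "\<gamma> \<in> plans \<mu> \<nu>"
  shows "interpolation_plan \<gamma> s t \<in> plans (interpolate \<gamma> s) (interpolate \<gamma> t)"
    "norm2 (interpolation_plan \<gamma> s t) (\<lambda>z. snd z - fst z) = \<bar>t - s\<bar> * norm2 \<gamma> (\<lambda>z. snd z - fst z)"
proof -
  note p = plansD[OF \<gamma>]
  note [measurable] = p(5,6)
  show "interpolation_plan \<gamma> s t \<in> plans (interpolate \<gamma> s) (interpolate \<gamma> t)"
    unfolding interpolation_plan_def
    by (rule plansI_coupling[OF p(1) _ _ _ interpolate_P2[OF \<gamma>] _ interpolate_P2[OF \<gamma>]])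
      (simp_all add: interpolate_def)
  show "norm2 (interpolation_plan \<gamma> s t) (\<lambda>z. snd z - fst z) = \<bar>t - s\<bar> * norm2 \<gamma> (\<lambda>z. snd z - fst z)"
    unfolding interpolation_plan_def norm2_scaleR[symmetric]
    by (subst norm2_distr) (simp_all only: fst_conv snd_conv interpolation_displacement, measurable)
qed

text \<open>
  Upper bounds for the three pieces \<open>[0, s]\<close>, \<open>[s, t]\<close>, \<open>[t, 1]\<close> are given by the plans that \<open>\<gamma>\<close> induces. They add up to
  \<open>W2 \<mu> \<nu>\<close>, so by the triangle inequality none of them can be strict.
\<close>

lemma W2_interpolate:
  fixes \<gamma> :: "('a::euclidean_space \<times> 'a) measure"
  assumes \<gamma>: "\<gamma> \<in> optimal_plans \<mu> \<nu>" and s: "s \<in> {0..1}" and t: "t \<in> {0..1}"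
  shows "W2 (interpolate \<gamma> s) (interpolate \<gamma> t) = \<bar>t - s\<bar> * W2 \<mu> \<nu>"
proof -
  have \<gamma>p: "\<gamma> \<in> plans \<mu> \<nu>" and n: "norm2 \<gamma> (\<lambda>z. snd z - fst z) = W2 \<mu> \<nu>"
    using \<gamma> by (simp_all add: optimal_plans_iff)
  note P = interpolate_P2[OF \<gamma>p]
  have le: "W2 (interpolate \<gamma> s) (interpolate \<gamma> t) \<le> \<bar>t - s\<bar> * W2 \<mu> \<nu>" for s t
    using W2_le[OF interpolation_plan_in_plans(1)[OF \<gamma>p]] interpolation_plan_in_plans(2)[OF \<gamma>p] n by metis
  have ordered: "W2 (interpolate \<gamma> s) (interpolate \<gamma> t) = (t - s) * W2 \<mu> \<nu>"
    if "0 \<le> s" "s \<le> t" "t \<le> 1" for s t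
  proof -
    have "W2 \<mu> \<nu> \<le> W2 (interpolate \<gamma> 0) (interpolate \<gamma> s) + W2 (interpolate \<gamma> s) (interpolate \<gamma> 1)"
      using W2_triangle[OF P[of 0] P[of s] P[of 1]] by (simp add: interpolate_0_1[OF \<gamma>p])
    also have "W2 (interpolate \<gamma> s) (interpolate \<gamma> 1)
        \<le> W2 (interpolate \<gamma> s) (interpolate \<gamma> t) + W2 (interpolate \<gamma> t) (interpolate \<gamma> 1)"
      by (rule W2_triangle[OF P P P])
    finally have "W2 \<mu> \<nu> \<le> s * W2 \<mu> \<nu> + (W2 (interpolate \<gamma> s) (interpolate \<gamma> t) + (1 - t) * W2 \<mu> \<nu>)"
      using le[of 0 s] le[of t 1] that by simp
    then show ?thesis using le[of s t] that by (simp add: algebra_simps)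
  qed
  show ?thesis
  proof (cases "s \<le> t")
    case True
    then show ?thesis using ordered[of s t] s t by simp
  next
    case False
    then show ?thesis using ordered[of t s] s t W2_commute[OF P P, of s t] by simp
  qed
qed

lemma interpolation_plan_optimal:
  fixes \<gamma> :: "('a::euclidean_space \<times> 'a) measure"
  assumes \<gamma>: "\<gamma> \<in> optimal_plans \<mu> \<nu>" and s: "s \<in> {0..1}" and t: "t \<in> {0..1}"
  shows "interpolation_plan \<gamma> s t \<in> optimal_plans (interpolate \<gamma> s) (interpolate \<gamma> t)"
  using interpolation_plan_in_plans[of \<gamma> \<mu> \<nu> s t] W2_interpolate[OF assms] \<gamma>
  by (simp add: optimal_plans_iff)

lemma square_integrable_interpolate:
  fixes \<gamma> :: "('a::euclidean_space \<times> 'a) measure"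
  assumes \<gamma>: "\<gamma> \<in> plans \<mu> \<nu>" and \<xi>: "square_integrable (interpolate \<gamma> s) \<xi>"
  shows "\<xi> \<in> borel_measurable borel"
    "square_integrable \<gamma> (\<lambda>z. \<xi> ((1 - s) *\<^sub>R fst z + s *\<^sub>R snd z))"
proof -
  note [measurable] = plansD(5,6)[OF \<gamma>]
  have "sets (interpolate \<gamma> s) = sets borel" by (simp add: interpolate_def)
  then show m: "\<xi> \<in> borel_measurable borel"
    using square_integrable_measurable[OF \<xi>] measurable_cong_sets by blast
  have T: "(\<lambda>z. (1 - s) *\<^sub>R fst z + s *\<^sub>R snd z) \<in> borel_measurable \<gamma>" by measurable
  show "square_integrable \<gamma> (\<lambda>z. \<xi> ((1 - s) *\<^sub>R fst z + s *\<^sub>R snd z))"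
    using \<xi> unfolding interpolate_def square_integrable_distr[OF T m] .
qed

lemma integral_interpolation_plan:
  fixes \<gamma> :: "('a::euclidean_space \<times> 'a) measure" and g :: "'a \<times> 'a \<Rightarrow> 'a"
  assumes \<gamma>: "\<gamma> \<in> plans \<mu> \<nu>" and g: "g \<in> borel_measurable borel"
  shows "(\<integral>z. g z \<bullet> (snd z - fst z) \<partial>interpolation_plan \<gamma> s t)
    = (t - s) * (\<integral>z. g ((1 - s) *\<^sub>R fst z + s *\<^sub>R snd z, (1 - t) *\<^sub>R fst z + t *\<^sub>R snd z) \<bullet> (snd z - fst z) \<partial>\<gamma>)"
proof -
  note [measurable] = plansD(5,6)[OF \<gamma>] g
  show ?thesis
    unfolding interpolation_plan_def
    by (subst integral_distr) (simp_all add: interpolation_displacement)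
qed

section \<open>Slopes, convexity and monotonicity\<close>

text \<open>
  For \<open>\<xi> = \<nabla>F[\<mu>\<^sub>t]\<close> this is the derivative of \<open>F\<close> along the geodesic induced by \<open>\<gamma>\<close> at time \<open>t\<close>.
\<close>

definition slope_along ::
    "('a::euclidean_space \<times> 'a) measure \<Rightarrow> ('a \<Rightarrow> 'a) \<Rightarrow> real \<Rightarrow> real" where
  "slope_along \<gamma> \<xi> t = (\<integral>z. \<xi> ((1 - t) *\<^sub>R fst z + t *\<^sub>R snd z) \<bullet> (snd z - fst z) \<partial>\<gamma>)"

text \<open>
  The plan from \<open>\<mu>\<^sub>s\<close> to \<open>\<mu>\<^sub>t\<close> induced by \<open>\<gamma>\<close> is optimal and its length is proportional to \<open>\<bar>t - s\<bar>\<close>, so the expansion of \<open>F\<close> at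
  \<open>\<mu>\<^sub>s\<close>, evaluated at this plan, is a first-order expansion in \<open>t\<close>.
\<close>

lemma derivative_along_geodesic:
  fixes \<gamma> :: "('a::euclidean_space \<times> 'a) measure"
  assumes \<gamma>: "\<gamma> \<in> optimal_plans \<mu> \<nu>" and s: "s \<in> {0..1}"
    and \<xi>: "\<xi> \<in> wasserstein_differential F (interpolate \<gamma> s)"
  shows "((\<lambda>t. F (interpolate \<gamma> t)) has_real_derivative slope_along \<gamma> \<xi> s) (at s within {0..1})"
  unfolding has_field_derivative_def has_derivative_within_alt
proof (intro conjI allI impI)
  show "bounded_linear ((*) (slope_along \<gamma> \<xi> s))" by (rule bounded_linear_mult_right)
  fix e :: real assume e: "0 < e"
  have \<gamma>p: "\<gamma> \<in> plans \<mu> \<nu>" using \<gamma> by (simp add: optimal_plans_iff)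
  define W where "W = W2 \<mu> \<nu>"
  have W: "0 \<le> W" unfolding W_def by (rule W2_nonneg[OF plans_P2[OF \<gamma>p]])
  \<comment> \<open>Dividing by \<open>W + 1\<close> instead of \<open>W\<close> covers the constant curve.\<close>
  have e': "0 < e / (W + 1)" using e W by simp
  have \<xi>s: "square_integrable (interpolate \<gamma> s) \<xi>"
    using \<xi> by (rule differential_square_integrable)
  note m [measurable] = square_integrable_interpolate(1)[OF \<gamma>p \<xi>s]
  obtain d where d: "d > 0" "\<And>\<rho> \<sigma>. \<rho> \<in> P2 \<Longrightarrow> W2 (interpolate \<gamma> s) \<rho> < d \<Longrightarrow> \<sigma> \<in> optimal_plans (interpolate \<gamma> s) \<rho> \<Longrightarrow>
      \<bar>F \<rho> - F (interpolate \<gamma> s) - (\<integral>x. \<xi> (fst x) \<bullet> (snd x - fst x) \<partial>\<sigma>)\<bar> \<le> e / (W + 1) * W2 (interpolate \<gamma> s) \<rho>"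
    using \<xi> e' unfolding wasserstein_differential_def by blast
  show "\<exists>d>0. \<forall>y\<in>{0..1}. norm (y - s) < d \<longrightarrow>
      norm (F (interpolate \<gamma> y) - F (interpolate \<gamma> s) - slope_along \<gamma> \<xi> s * (y - s)) \<le> e * norm (y - s)"
  proof (intro exI[of _ "d / (W + 1)"] conjI ballI impI)
    show "0 < d / (W + 1)" using d(1) W by simp
    fix t :: real assume t: "t \<in> {0..1}" and near: "norm (t - s) < d / (W + 1)"
    have W2: "W2 (interpolate \<gamma> s) (interpolate \<gamma> t) = \<bar>t - s\<bar> * W"
      unfolding W_def by (rule W2_interpolate[OF \<gamma> s t])
    have "\<bar>t - s\<bar> * W \<le> \<bar>t - s\<bar> * (W + 1)" by (intro mult_left_mono) auto
    also have "\<dots> < d" using near W by (simp add: pos_less_divide_eq)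
    finally have lt: "W2 (interpolate \<gamma> s) (interpolate \<gamma> t) < d" by (simp add: W2)
    have "(\<integral>x. \<xi> (fst x) \<bullet> (snd x - fst x) \<partial>interpolation_plan \<gamma> s t) = slope_along \<gamma> \<xi> s * (t - s)"
      using integral_interpolation_plan[OF \<gamma>p, of "\<lambda>z. \<xi> (fst z)" s t] by (simp add: slope_along_def)
    then have "\<bar>F (interpolate \<gamma> t) - F (interpolate \<gamma> s) - slope_along \<gamma> \<xi> s * (t - s)\<bar>
        \<le> e / (W + 1) * (\<bar>t - s\<bar> * W)"
      using d(2)[OF interpolate_P2[OF \<gamma>p] lt interpolation_plan_optimal[OF \<gamma> s t]] by (simp only: W2)
    also have "\<dots> = e * \<bar>t - s\<bar> * (W / (W + 1))" by simp
    also have "\<dots> \<le> e * \<bar>t - s\<bar> * 1" using e W by (intro mult_left_mono) auto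
    finally show "norm (F (interpolate \<gamma> t) - F (interpolate \<gamma> s) - slope_along \<gamma> \<xi> s * (t - s)) \<le> e * norm (t - s)"
      by simp
  qed
qed

lemma convexity_above_tangent:
  fixes f :: "real \<Rightarrow> real"
  assumes D: "(f has_real_derivative D) (at 0 within {0..1})"
    and conv: "\<And>t. t \<in> {0..1} \<Longrightarrow> f t \<le> (1 - t) * f 0 + t * f 1 - c * t * (1 - t)"
  shows "D + c \<le> f 1 - f 0"
proof -
  have at: "at (0::real) within {0..1} = at_right 0" by (simp add: at_within_Icc_at_right)
  have quot: "((\<lambda>t. (f t - f 0) / (t - 0)) \<longlongrightarrow> D) (at_right 0)"
    using D unfolding has_field_derivative_iff at .
  have bound: "((\<lambda>t. f 1 - f 0 - c * (1 - t)) \<longlongrightarrow> f 1 - f 0 - c * (1 - 0)) (at_right 0)"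
    by (intro tendsto_intros)
  have "\<forall>\<^sub>F t in at_right 0. (f t - f 0) / (t - 0) \<le> f 1 - f 0 - c * (1 - t)"
    unfolding eventually_at_right_field
  proof (intro exI[of _ 1] conjI allI impI)
    fix t :: real assume t: "0 < t" "t < 1"
    have "f t - f 0 \<le> (f 1 - f 0 - c * (1 - t)) * t" using conv[of t] t by (simp add: algebra_simps)
    then show "(f t - f 0) / (t - 0) \<le> f 1 - f 0 - c * (1 - t)" using t by (simp add: pos_divide_le_eq)
  qed simp
  with bound quot have "D \<le> f 1 - f 0 - c * (1 - 0)"
    by (rule tendsto_le[OF trivial_limit_at_right_real])
  then show ?thesis by simp
qed

text \<open>
  Subtracting \<open>c t\<^sup>2\<close> reduces to the case of an increasing derivative; the mean value theorem on \<open>[0, t]\<close> and on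
  \<open>[t, 1]\<close> then compares the two difference quotients. The derivative is one-sided at the endpoints, where the
  curve of measures ends.
\<close>

lemma convexity_from_monotone_derivative:
  fixes f :: "real \<Rightarrow> real"
  assumes D: "\<And>t. t \<in> {0..1} \<Longrightarrow> (f has_real_derivative f' t) (at t within {0..1})"
    and mono: "\<And>s t. 0 \<le> s \<Longrightarrow> s < t \<Longrightarrow> t \<le> 1 \<Longrightarrow> 2 * c * (t - s) \<le> f' t - f' s"
    and t: "t \<in> {0..1}"
  shows "f t \<le> (1 - t) * f 0 + t * f 1 - c * t * (1 - t)"
proof (cases "t = 0 \<or> t = 1")
  case False
  then have t: "0 < t" "t < 1" using t by auto
  define g where "g x = f x - c * x\<^sup>2" for x
  have mvt: "\<exists>x. a < x \<and> x < b \<and> g b - g a = (f' x - 2 * c * x) * (b - a)" if ab: "0 \<le> a" "a < b" "b \<le> 1" for a b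
  proof -
    have "(g has_derivative (*) (f' x - 2 * c * x)) (at x within {a..b})" if x: "x \<in> {a..b}" for x
    proof -
      have "(f has_real_derivative f' x) (at x within {a..b})"
        by (rule DERIV_subset[OF D[of x]]) (use x ab in auto)
      moreover have "((\<lambda>x. c * x\<^sup>2) has_real_derivative c * (2 * x)) (at x within {a..b})"
        by (auto intro!: derivative_eq_intros)
      ultimately have "(g has_real_derivative f' x - c * (2 * x)) (at x within {a..b})"
        unfolding g_def by (rule DERIV_diff)
      moreover have "f' x - c * (2 * x) = f' x - 2 * c * x" by simp
      ultimately show ?thesis unfolding has_field_derivative_def by (simp only:)
    qed
    from mvt_simple[OF ab(2) this] show ?thesis by (simp add: Bex_def)
  qed
  obtain x where x: "0 < x" "x < t" "g t - g 0 = (f' x - 2 * c * x) * (t - 0)" using mvt[OF order_refl t(1) less_imp_le[OF t(2)]] by blast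
  obtain y where y: "t < y" "y < 1" "g 1 - g t = (f' y - 2 * c * y) * (1 - t)" using mvt[OF less_imp_le[OF t(1)] t(2) order_refl] by blast
  have "f' x - 2 * c * x \<le> f' y - 2 * c * y" using mono[of x y] x y by (simp add: algebra_simps)
  then have "(f' x - 2 * c * x) * (t * (1 - t)) \<le> (f' y - 2 * c * y) * (t * (1 - t))"
    using t by (intro mult_right_mono) simp_all
  moreover have "(g t - g 0) * (1 - t) = (f' x - 2 * c * x) * (t * (1 - t))" unfolding x(3) by simp
  moreover have "(g 1 - g t) * t = (f' y - 2 * c * y) * (t * (1 - t))" unfolding y(3) by simp
  moreover have "(g t - g 0) * (1 - t) - (g 1 - g t) * t = f t - ((1 - t) * f 0 + t * f 1 - c * t * (1 - t))"
    by (simp add: g_def power2_eq_square algebra_simps)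
  ultimately show ?thesis by linarith
qed auto

lemma slope_along_swap:
  fixes \<gamma> :: "('a::euclidean_space \<times> 'a) measure"
  assumes \<gamma>: "\<gamma> \<in> plans \<mu> \<nu>" and \<xi> [measurable]: "\<xi> \<in> borel_measurable borel"
  shows "slope_along (distr \<gamma> borel prod.swap) \<xi> t = - slope_along \<gamma> \<xi> (1 - t)"
proof -
  note [measurable] = plansD(5,6)[OF \<gamma>] swap_measurable[OF \<gamma>]
  have "slope_along (distr \<gamma> borel prod.swap) \<xi> t
      = (\<integral>z. \<xi> ((1 - t) *\<^sub>R snd z + t *\<^sub>R fst z) \<bullet> (fst z - snd z) \<partial>\<gamma>)"
    unfolding slope_along_def by (subst integral_distr) simp_all
  also have "\<dots> = (\<integral>z. - (\<xi> ((1 - (1 - t)) *\<^sub>R fst z + (1 - t) *\<^sub>R snd z) \<bullet> (snd z - fst z)) \<partial>\<gamma>)"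
    by (rule Bochner_Integration.integral_cong)
      (simp_all add: add.commute inner_minus_right[symmetric] del: inner_minus_right)
  also have "\<dots> = - slope_along \<gamma> \<xi> (1 - t)"
    unfolding slope_along_def by (rule Bochner_Integration.integral_minus)
  finally show ?thesis .
qed

lemma abs_slope_along_le:
  fixes \<gamma> :: "('a::euclidean_space \<times> 'a) measure"
  assumes \<gamma>: "\<gamma> \<in> optimal_plans \<mu> \<nu>" and \<xi>: "square_integrable (interpolate \<gamma> t) \<xi>"
  shows "\<bar>slope_along \<gamma> \<xi> t\<bar> \<le> norm2 \<gamma> (\<lambda>z. \<xi> ((1 - t) *\<^sub>R fst z + t *\<^sub>R snd z)) * W2 \<mu> \<nu>"
proof -
  have \<gamma>p: "\<gamma> \<in> plans \<mu> \<nu>" and n: "norm2 \<gamma> (\<lambda>z. snd z - fst z) = W2 \<mu> \<nu>"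
    using \<gamma> by (simp_all add: optimal_plans_iff)
  show ?thesis
    unfolding slope_along_def n[symmetric]
    by (rule Cauchy_Schwarz_integral[OF square_integrable_interpolate(2)[OF \<gamma>p \<xi>] plans_displacement[OF \<gamma>p]])
qed

text \<open>
  The measure \<open>\<mu>\<^sub>t\<close> lies between \<open>\<mu>\<close> and \<open>\<nu>\<close>, so the plan from \<open>\<mu>\<close> to \<open>\<mu>\<^sub>t\<close> induced by \<open>\<gamma>\<close> and the plan \<open>\<sigma>\<close> are aligned. The
  first-order term of \<open>\<sigma>\<close> is thereby computed from the part of \<open>\<gamma>\<close> that precedes \<open>t\<close>. If \<open>W2 \<mu> \<nu> = 0\<close>, both sides vanish.
\<close>

lemma slope_determined_at_interior_point:
  fixes \<gamma> :: "('a::euclidean_space \<times> 'a) measure"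
  assumes \<gamma>: "\<gamma> \<in> optimal_plans \<mu> \<nu>" and t: "0 < t" "t < 1"
    and \<sigma>: "\<sigma> \<in> optimal_plans (interpolate \<gamma> t) \<nu>" and \<xi>: "square_integrable (interpolate \<gamma> t) \<xi>"
  shows "slope_along \<sigma> \<xi> 0 = (1 - t) * slope_along \<gamma> \<xi> t"
proof -
  have \<gamma>p: "\<gamma> \<in> plans \<mu> \<nu>" and \<sigma>p: "\<sigma> \<in> plans (interpolate \<gamma> t) \<nu>"
    using \<gamma> \<sigma> by (simp_all add: optimal_plans_iff)
  note ends = interpolate_0_1[OF \<gamma>p]
  note [measurable] = square_integrable_interpolate(1)[OF \<gamma>p \<xi>]
  define W where "W = W2 \<mu> \<nu>"
  have W1: "W2 \<mu> (interpolate \<gamma> t) = t * W" and W2: "W2 (interpolate \<gamma> t) \<nu> = (1 - t) * W"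
    using W2_interpolate[OF \<gamma>, of 0 t] W2_interpolate[OF \<gamma>, of t 1] t by (simp_all add: ends W_def)
  show ?thesis
  proof (cases "W = 0")
    case True
    have "square_integrable (interpolate \<sigma> 0) \<xi>" using \<xi> by (simp add: interpolate_0_1[OF \<sigma>p])
    from abs_slope_along_le[OF \<sigma> this] abs_slope_along_le[OF \<gamma> \<xi>] show ?thesis
      using True W2 by (simp add: W_def)
  next
    case False
    have "interpolation_plan \<gamma> 0 t \<in> optimal_plans (interpolate \<gamma> 0) (interpolate \<gamma> t)"
      by (rule interpolation_plan_optimal[OF \<gamma>]) (use t in auto)
    then have \<alpha>: "interpolation_plan \<gamma> 0 t \<in> optimal_plans \<mu> (interpolate \<gamma> t)" by (simp only: ends)
    have "W2 \<mu> \<nu> = W2 \<mu> (interpolate \<gamma> t) + W2 (interpolate \<gamma> t) \<nu>"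
      unfolding W1 W2 by (simp add: W_def algebra_simps)
    from barycentre_of_aligned_plans[OF \<alpha> \<sigma> this] \<xi>
    have "(1 - t) * W * (\<integral>z. \<xi> (snd z) \<bullet> (snd z - fst z) \<partial>interpolation_plan \<gamma> 0 t)
        = t * W * (\<integral>z. \<xi> (fst z) \<bullet> (snd z - fst z) \<partial>\<sigma>)"
      by (simp add: L2_iff W1 W2)
    also have "(\<integral>z. \<xi> (snd z) \<bullet> (snd z - fst z) \<partial>interpolation_plan \<gamma> 0 t) = t * slope_along \<gamma> \<xi> t"
      using integral_interpolation_plan[OF \<gamma>p, of "\<lambda>z. \<xi> (snd z)" 0 t] by (simp add: slope_along_def)
    also have "(\<integral>z. \<xi> (fst z) \<bullet> (snd z - fst z) \<partial>\<sigma>) = slope_along \<sigma> \<xi> 0"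
      by (simp add: slope_along_def)
    finally have "(t * W) * ((1 - t) * slope_along \<gamma> \<xi> t) = (t * W) * slope_along \<sigma> \<xi> 0"
      by (simp only: mult.assoc mult.left_commute)
    then show ?thesis using False t by simp
  qed
qed

text \<open>
  Convexity holds along some geodesic from \<open>\<mu>\<^sub>t\<close> to \<open>\<nu>\<close>. Its slope at \<open>\<mu>\<^sub>t\<close> is a multiple of the one along \<open>\<gamma>\<close>, so the resulting tangent
  inequality speaks of \<open>\<gamma>\<close> only.
\<close>

lemma convexity_gives_tangent_at_interior_point:
  fixes \<gamma> :: "('a::euclidean_space \<times> 'a) measure"
  assumes F: "geodesically_convex lam F" and \<gamma>: "\<gamma> \<in> optimal_plans \<mu> \<nu>" and t: "0 < t" "t < 1"
    and \<xi>: "\<xi> \<in> wasserstein_differential F (interpolate \<gamma> t)"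
  shows "(1 - t) * slope_along \<gamma> \<xi> t + lam / 2 * ((1 - t) * W2 \<mu> \<nu>)\<^sup>2 \<le> F \<nu> - F (interpolate \<gamma> t)"
proof -
  have \<gamma>p: "\<gamma> \<in> plans \<mu> \<nu>" using \<gamma> by (simp add: optimal_plans_iff)
  have \<xi>s: "square_integrable (interpolate \<gamma> t) \<xi>"
    using \<xi> by (rule differential_square_integrable)
  have W: "W2 (interpolate \<gamma> t) \<nu> = (1 - t) * W2 \<mu> \<nu>"
    using W2_interpolate[OF \<gamma>, of t 1] t by (simp add: interpolate_0_1[OF \<gamma>p])
  obtain m where m: "wasserstein_geodesic (interpolate \<gamma> t) \<nu> m"
    and conv: "\<forall>r\<in>{0..1}. F (m r) \<le> (1 - r) * F (interpolate \<gamma> t) + r * F \<nu>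
      - lam / 2 * r * (1 - r) * (W2 (interpolate \<gamma> t) \<nu>)\<^sup>2"
    using F interpolate_P2[OF \<gamma>p] plans_P2(2)[OF \<gamma>p] unfolding geodesically_convex_def by blast
  obtain \<sigma> where \<sigma>: "\<sigma> \<in> optimal_plans (interpolate \<gamma> t) \<nu>" and m\<sigma>: "\<forall>r\<in>{0..1}. m r = interpolate \<sigma> r"
    using m unfolding wasserstein_geodesic_def interpolate_def[symmetric] by blast
  have \<sigma>p: "\<sigma> \<in> plans (interpolate \<gamma> t) \<nu>" using \<sigma> by (simp add: optimal_plans_iff)
  note ends = interpolate_0_1[OF \<sigma>p]
  have "((\<lambda>r. F (interpolate \<sigma> r)) has_real_derivative slope_along \<sigma> \<xi> 0) (at 0 within {0..1})"
    by (rule derivative_along_geodesic[OF \<sigma>]) (use \<xi> in \<open>simp_all add: ends\<close>)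
  then have "slope_along \<sigma> \<xi> 0 + lam / 2 * (W2 (interpolate \<gamma> t) \<nu>)\<^sup>2
      \<le> F (interpolate \<sigma> 1) - F (interpolate \<sigma> 0)"
  proof (rule convexity_above_tangent)
    fix r :: real assume r: "r \<in> {0..1}"
    have "lam / 2 * r * (1 - r) * (W2 (interpolate \<gamma> t) \<nu>)\<^sup>2 = lam / 2 * (W2 (interpolate \<gamma> t) \<nu>)\<^sup>2 * r * (1 - r)"
      by simp
    then show "F (interpolate \<sigma> r) \<le> (1 - r) * F (interpolate \<sigma> 0) + r * F (interpolate \<sigma> 1)
        - lam / 2 * (W2 (interpolate \<gamma> t) \<nu>)\<^sup>2 * r * (1 - r)"
      using conv[rule_format, OF r] m\<sigma>[rule_format, OF r] by (simp only: ends)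
  qed
  then have "slope_along \<sigma> \<xi> 0 + lam / 2 * (W2 (interpolate \<gamma> t) \<nu>)\<^sup>2 \<le> F \<nu> - F (interpolate \<gamma> t)"
    by (simp only: ends)
  then show ?thesis
    unfolding slope_determined_at_interior_point[OF \<gamma> t \<sigma> \<xi>s] W .
qed

text \<open>
  The tangent inequalities at \<open>\<mu>\<^sub>t\<close> towards \<open>\<nu>\<close> and, after swapping the coordinates, towards \<open>\<mu>\<close> carry opposite
  slopes, which cancel in the convex combination with weights \<open>t\<close> and \<open>1 - t\<close>.
\<close>

lemma convexity_along_every_geodesic:
  fixes \<gamma> :: "('a::euclidean_space \<times> 'a) measure"
  assumes diff: "wasserstein_differentiable F" and F: "geodesically_convex lam F"
    and \<gamma>: "\<gamma> \<in> optimal_plans \<mu> \<nu>" and t: "t \<in> {0..1}"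
  shows "F (interpolate \<gamma> t) \<le> (1 - t) * F \<mu> + t * F \<nu> - lam / 2 * (W2 \<mu> \<nu>)\<^sup>2 * t * (1 - t)"
proof -
  have \<gamma>p: "\<gamma> \<in> plans \<mu> \<nu>" using \<gamma> by (simp add: optimal_plans_iff)
  note ends = interpolate_0_1[OF \<gamma>p] and P = plans_P2[OF \<gamma>p]
  show ?thesis
  proof (cases "t = 0 \<or> t = 1")
    case True
    then show ?thesis by (auto simp: ends)
  next
    case False
    then have t: "0 < t" "t < 1" using t by auto
    define \<xi> where "\<xi> = wasserstein_gradient F (interpolate \<gamma> t)"
    have \<xi>: "\<xi> \<in> wasserstein_differential F (interpolate \<gamma> t)"
      unfolding \<xi>_def using diff interpolate_P2[OF \<gamma>p]
      by (intro wasserstein_gradient_in_differential) (simp_all add: wasserstein_differentiable_def)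
    have \<xi>m: "\<xi> \<in> borel_measurable borel"
      by (rule square_integrable_interpolate(1)[OF \<gamma>p differential_square_integrable[OF \<xi>]])
    define \<gamma>' where "\<gamma>' = distr \<gamma> borel prod.swap"
    have \<gamma>': "\<gamma>' \<in> optimal_plans \<nu> \<mu>" unfolding \<gamma>'_def by (rule swap_optimal_plans[OF \<gamma>])
    have i: "interpolate \<gamma>' (1 - t) = interpolate \<gamma> t"
      unfolding \<gamma>'_def interpolate_swap[OF \<gamma>p] by simp
    have sl: "slope_along \<gamma>' \<xi> (1 - t) = - slope_along \<gamma> \<xi> t"
      unfolding \<gamma>'_def slope_along_swap[OF \<gamma>p \<xi>m] by simp
    define D where "D = slope_along \<gamma> \<xi> t"
    define K where "K = lam / 2 * (W2 \<mu> \<nu>)\<^sup>2"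
    have A: "(1 - t) * D + K * (1 - t)\<^sup>2 \<le> F \<nu> - F (interpolate \<gamma> t)"
    proof -
      have "lam / 2 * ((1 - t) * W2 \<mu> \<nu>)\<^sup>2 = K * (1 - t)\<^sup>2" by (simp add: K_def power_mult_distrib)
      then show ?thesis
        using convexity_gives_tangent_at_interior_point[OF F \<gamma> t \<xi>] by (simp only: D_def)
    qed
    have "(1 - (1 - t)) * slope_along \<gamma>' \<xi> (1 - t) + lam / 2 * ((1 - (1 - t)) * W2 \<nu> \<mu>)\<^sup>2
        \<le> F \<mu> - F (interpolate \<gamma>' (1 - t))"
      by (rule convexity_gives_tangent_at_interior_point[OF F \<gamma>']) (use t \<xi> i in simp_all)
    moreover have "lam / 2 * ((1 - (1 - t)) * W2 \<nu> \<mu>)\<^sup>2 = K * t\<^sup>2"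
      by (simp add: K_def power_mult_distrib W2_commute[OF P(2,1)])
    moreover have "(1 - (1 - t)) * slope_along \<gamma>' \<xi> (1 - t) = - (t * D)"
      by (simp add: sl D_def)
    ultimately have B: "- (t * D) + K * t\<^sup>2 \<le> F \<mu> - F (interpolate \<gamma> t)"
      by (simp only: i)
    have "t * ((1 - t) * D + K * (1 - t)\<^sup>2) + (1 - t) * (- (t * D) + K * t\<^sup>2)
        \<le> t * (F \<nu> - F (interpolate \<gamma> t)) + (1 - t) * (F \<mu> - F (interpolate \<gamma> t))"
      using A B t by (intro add_mono mult_left_mono) auto
    moreover have "t * ((1 - t) * D + K * (1 - t)\<^sup>2) + (1 - t) * (- (t * D) + K * t\<^sup>2) = K * t * (1 - t)"
      by (simp add: power2_eq_square algebra_simps)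
    moreover have "t * (F \<nu> - F (interpolate \<gamma> t)) + (1 - t) * (F \<mu> - F (interpolate \<gamma> t))
        = (1 - t) * F \<mu> + t * F \<nu> - F (interpolate \<gamma> t)"
      by (simp add: algebra_simps)
    ultimately show ?thesis unfolding K_def[symmetric] by linarith
  qed
qed

theorem theorem1p2:
  fixes F :: "'a::euclidean_space measure \<Rightarrow> real" and lam :: real
  assumes "wasserstein_differentiable F"
  shows "geodesically_convex lam F \<longleftrightarrow>
    (\<forall>\<mu>1\<in>P2. \<forall>\<mu>2\<in>P2. \<forall>\<gamma>\<in>optimal_plans \<mu>1 \<mu>2.
      (\<integral>x. (wasserstein_gradient F \<mu>2 (snd x) - wasserstein_gradient F \<mu>1 (fst x))
             \<bullet> (snd x - fst x) \<partial>\<gamma>) \<ge> lam * (W2 \<mu>1 \<mu>2)\<^sup>2)"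
    (is "?convex \<longleftrightarrow> ?monotone")
proof -
  have grad: "wasserstein_gradient F \<mu> \<in> wasserstein_differential F \<mu>" if "\<mu> \<in> P2" for \<mu>
    using assms that by (simp add: wasserstein_differentiable_def wasserstein_gradient_in_differential)
  then have grads: "square_integrable \<mu> (wasserstein_gradient F \<mu>)" if "\<mu> \<in> P2" for \<mu>
    using that differential_square_integrable by blast
  have split: "(\<integral>x. (wasserstein_gradient F \<mu>2 (snd x) - wasserstein_gradient F \<mu>1 (fst x)) \<bullet> (snd x - fst x) \<partial>\<gamma>)
      = (\<integral>x. wasserstein_gradient F \<mu>2 (snd x) \<bullet> (snd x - fst x) \<partial>\<gamma>)
        - (\<integral>x. wasserstein_gradient F \<mu>1 (fst x) \<bullet> (snd x - fst x) \<partial>\<gamma>)"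
    if "\<gamma> \<in> plans \<mu>1 \<mu>2" for \<gamma> \<mu>1 \<mu>2
    unfolding inner_diff_left
    by (intro Bochner_Integration.integral_diff square_integrable_inner plans_displacement[OF that]
        plans_fst(1)[OF that] plans_snd(1)[OF that] grads plans_P2[OF that])
  show ?thesis
  proof
    assume conv: ?convex
    show ?monotone
    proof (intro ballI)
      fix \<mu>1 \<mu>2 :: "'a measure" and \<gamma>
      assume P: "\<mu>1 \<in> P2" "\<mu>2 \<in> P2" and \<gamma>: "\<gamma> \<in> optimal_plans \<mu>1 \<mu>2"
      \<comment> \<open>Convexity along the very plan under test gives a tangent inequality at either end of it; adding
        the two eliminates \<open>F\<close>.\<close>
      have tangent: "slope_along \<eta> (wasserstein_gradient F \<mu>) 0 + lam / 2 * (W2 \<mu> \<nu>)\<^sup>2 \<le> F \<nu> - F \<mu>"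
        if \<eta>: "\<eta> \<in> optimal_plans \<mu> \<nu>" for \<eta> \<mu> \<nu>
      proof -
        have \<eta>p: "\<eta> \<in> plans \<mu> \<nu>" using \<eta> by (simp add: optimal_plans_iff)
        note ends = interpolate_0_1[OF \<eta>p]
        have "((\<lambda>t. F (interpolate \<eta> t)) has_real_derivative slope_along \<eta> (wasserstein_gradient F \<mu>) 0)
            (at 0 within {0..1})"
          by (rule derivative_along_geodesic[OF \<eta>]) (use grad plans_P2[OF \<eta>p] in \<open>simp_all add: ends\<close>)
        from convexity_above_tangent[OF this, of "lam / 2 * (W2 \<mu> \<nu>)\<^sup>2"]
        show ?thesis using convexity_along_every_geodesic[OF assms conv \<eta>] by (simp add: ends)
      qed
      have \<gamma>p: "\<gamma> \<in> plans \<mu>1 \<mu>2" using \<gamma> by (simp add: optimal_plans_iff)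
      have "square_integrable (interpolate \<gamma> 1) (wasserstein_gradient F \<mu>2)"
        using grads[OF P(2)] by (simp add: interpolate_0_1[OF \<gamma>p])
      note m = square_integrable_interpolate(1)[OF \<gamma>p this]
      have "- slope_along \<gamma> (wasserstein_gradient F \<mu>2) 1 + lam / 2 * (W2 \<mu>1 \<mu>2)\<^sup>2 \<le> F \<mu>1 - F \<mu>2"
        using tangent[OF swap_optimal_plans[OF \<gamma>]]
        unfolding slope_along_swap[OF \<gamma>p m] W2_commute[OF P(2,1)] by simp
      with tangent[OF \<gamma>]
      have "lam * (W2 \<mu>1 \<mu>2)\<^sup>2 \<le> slope_along \<gamma> (wasserstein_gradient F \<mu>2) 1 - slope_along \<gamma> (wasserstein_gradient F \<mu>1) 0"
        by simp
      then show "(\<integral>x. (wasserstein_gradient F \<mu>2 (snd x) - wasserstein_gradient F \<mu>1 (fst x)) \<bullet> (snd x - fst x) \<partial>\<gamma>)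
          \<ge> lam * (W2 \<mu>1 \<mu>2)\<^sup>2"
        unfolding split[OF \<gamma>p] by (simp add: slope_along_def)
    qed
  next
    assume mono: ?monotone
    show ?convex
      unfolding geodesically_convex_def
    proof (intro ballI)
      fix \<mu>1 \<mu>2 :: "'a measure" assume P: "\<mu>1 \<in> P2" "\<mu>2 \<in> P2"
      obtain \<gamma> where \<gamma>: "\<gamma> \<in> optimal_plans \<mu>1 \<mu>2" using optimal_plan_exists[OF P] by blast
      then have \<gamma>p: "\<gamma> \<in> plans \<mu>1 \<mu>2" by (simp add: optimal_plans_iff)
      define W where "W = W2 \<mu>1 \<mu>2"
      define g where "g t = wasserstein_gradient F (interpolate \<gamma> t)" for t
      note gm [measurable] = square_integrable_interpolate(1)[OF \<gamma>p grads[OF interpolate_P2[OF \<gamma>p]], folded g_def]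
      have D: "((\<lambda>t. F (interpolate \<gamma> t)) has_real_derivative slope_along \<gamma> (g t) t) (at t within {0..1})"
        if "t \<in> {0..1}" for t
        unfolding g_def by (rule derivative_along_geodesic[OF \<gamma> that grad[OF interpolate_P2[OF \<gamma>p]]])
      have slopes: "2 * (lam / 2 * W\<^sup>2) * (t - s) \<le> slope_along \<gamma> (g t) t - slope_along \<gamma> (g s) s"
        if st: "0 \<le> s" "s < t" "t \<le> 1" for s t
      proof -
        have I: "s \<in> {0..1}" "t \<in> {0..1}" using st by auto
        have "lam * (W2 (interpolate \<gamma> s) (interpolate \<gamma> t))\<^sup>2
            \<le> (\<integral>x. (g t (snd x) - g s (fst x)) \<bullet> (snd x - fst x) \<partial>interpolation_plan \<gamma> s t)"
          unfolding g_def using mono interpolate_P2[OF \<gamma>p] interpolation_plan_optimal[OF \<gamma> I] by blast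
        also have "\<dots> = (\<integral>x. g t (snd x) \<bullet> (snd x - fst x) \<partial>interpolation_plan \<gamma> s t)
            - (\<integral>x. g s (fst x) \<bullet> (snd x - fst x) \<partial>interpolation_plan \<gamma> s t)"
          unfolding g_def by (rule split[OF interpolation_plan_in_plans(1)[OF \<gamma>p]])
        also have "\<dots> = (t - s) * (slope_along \<gamma> (g t) t - slope_along \<gamma> (g s) s)"
          using integral_interpolation_plan[OF \<gamma>p, of "\<lambda>z. g t (snd z)" s t]
            integral_interpolation_plan[OF \<gamma>p, of "\<lambda>z. g s (fst z)" s t]
          by (simp add: slope_along_def right_diff_distrib)
        finally have "(t - s) * (lam * W\<^sup>2 * (t - s)) \<le> (t - s) * (slope_along \<gamma> (g t) t - slope_along \<gamma> (g s) s)"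
          unfolding W2_interpolate[OF \<gamma> I] W_def
          by (simp add: power_mult_distrib power2_eq_square mult_ac)
        then show ?thesis using st by simp
      qed
      have "F (interpolate \<gamma> t) \<le> (1 - t) * F \<mu>1 + t * F \<mu>2 - lam / 2 * W\<^sup>2 * t * (1 - t)" if "t \<in> {0..1}" for t
        using convexity_from_monotone_derivative[OF D slopes that] by (simp add: interpolate_0_1[OF \<gamma>p])
      moreover have "wasserstein_geodesic \<mu>1 \<mu>2 (interpolate \<gamma>)"
        unfolding wasserstein_geodesic_def interpolate_def using \<gamma> by blast
      moreover have "lam / 2 * t * (1 - t) * W\<^sup>2 = lam / 2 * W\<^sup>2 * t * (1 - t)" for t by simp
      ultimately show "\<exists>m. wasserstein_geodesic \<mu>1 \<mu>2 m \<and> (\<forall>t\<in>{0..1}.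
          F (m t) \<le> (1 - t) * F \<mu>1 + t * F \<mu>2 - lam / 2 * t * (1 - t) * (W2 \<mu>1 \<mu>2)\<^sup>2)"
        unfolding W_def by (intro exI[of _ "interpolate \<gamma>"]) presburger
    qed
  qed
qed

end
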